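(* Let $k$ and $n$ be integers with $3\le k\le 12$ and $n\ge k+3$. Then $k\in\mathcal K_n$, i.e., the multiplicative inverse function $f_{\mathrm{inv}}$ on $\mathbb F_{2^n}$ is not $k$th order sum-free.
   Context: The multiplicative inverse function $f_{\mathrm{inv}}:\mathbb F_{2^n}\to\mathbb F_{2^n}$ is defined by $f_{\mathrm{inv}}(x)=x^{-1}$ for $x\ne 0$ and $f_{\mathrm{inv}}(0)=0$. A function $f:\mathbb F_{2^n}\to\mathbb F_{2^n}$ is $k$th order sum-free if $\sum_{x\in A}f(x)\ne 0$ for every $k$-dimensional $\mathbb F_2$-affine subspace $A$ of $\mathbb F_{2^n}$. $\mathcal K_n$ denotes the set of integers $1\le k\le n-1$ such that $f_{\mathrm{inv}}$ on $\mathbb F_{2^n}$ is not $k$th order sum-free. *)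

theory Defs
  imports "HOL-Library.Z2" "HOL-Library.Cardinality" "HOL-Number_Theory.Number_Theory"
begin

text \<open>
  The field with \<open>2^n\<close> elements is any type of class \<open>{field, finite}\<close> of cardinality \<open>2^n\<close>.
  Its prime field is represented by the type \<^typ>\<open>bit\<close>, which acts on it as follows. This makes
  it a vector space exactly when the characteristic is 2 (see \<open>vector_space_f2_scale\<close> below), so
  that \<^const>\<open>module.subspace\<close> and \<^const>\<open>vector_space.dim\<close> have their usual meaning.
\<close>

definition f2_scale :: "bit \<Rightarrow> 'a::field \<Rightarrow> 'a" where
  "f2_scale c x = (if c = 0 then 0 else x)"

lemma vector_space_f2_scale:
  assumes "CARD('a::{field,finite}) = 2 ^ n"
  shows "vector_space (f2_scale :: bit \<Rightarrow> 'a \<Rightarrow> 'a)"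
proof -
  have "CHAR('a) dvd 2 ^ n"
    using CHAR_dvd_CARD[where 'a = 'a] assms by simp
  moreover have "prime CHAR('a)"
    by (rule prime_CHAR_semidom) (rule finite_imp_CHAR_pos, simp)
  ultimately have "CHAR('a) = 2"
    using prime_dvd_power primes_dvd_imp_eq two_is_prime_nat by blast
  then have two: "(1 :: 'a) + 1 = 0"
    using of_nat_CHAR[where 'a = 'a] by simp
  have dbl: "x + x = 0" for x :: 'a
    using two by (metis distrib_left mult.right_neutral mult_zero_right)
  show ?thesis
  proof
    fix a b :: bit and x y :: 'a
    show "f2_scale a (x + y) = f2_scale a x + f2_scale a y"
      by (simp add: f2_scale_def)
    show "f2_scale (a + b) x = f2_scale a x + f2_scale b x"
      by (cases a; cases b) (simp_all add: f2_scale_def dbl)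
    show "f2_scale a (f2_scale b x) = f2_scale (a * b) x"
      by (cases a; cases b) (simp_all add: f2_scale_def)
    show "f2_scale 1 x = x"
      by (simp add: f2_scale_def)
  qed
qed

definition f2_affine_subspace :: "nat \<Rightarrow> 'a::field set \<Rightarrow> bool" where
  "f2_affine_subspace k A \<longleftrightarrow>
     (\<exists>a V. module.subspace f2_scale V \<and> vector_space.dim f2_scale V = k \<and> A = (\<lambda>v. a + v) ` V)"

definition sum_free :: "nat \<Rightarrow> ('a::{field,finite} \<Rightarrow> 'a) \<Rightarrow> bool" where
  "sum_free k f \<longleftrightarrow> (\<forall>A. f2_affine_subspace k A \<longrightarrow> (\<Sum>x\<in>A. f x) \<noteq> 0)"

definition f_inv :: "'a::field \<Rightarrow> 'a" where
  "f_inv x = (if x = 0 then 0 else inverse x)"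

text \<open>
  \<open>\<K> TYPE('a) n\<close> is the set \<open>\<K>\<^sub>n\<close>, computed in the model \<^typ>\<open>'a\<close> of the field with \<open>2^n\<close> elements;
  it is meant to be used only when \<open>CARD('a) = 2^n\<close>.
\<close>

definition \<K> :: "'a::{field,finite} itself \<Rightarrow> nat \<Rightarrow> nat set" where
  "\<K> _ n = {k. 1 \<le> k \<and> k \<le> n - 1 \<and> \<not> sum_free k (f_inv :: 'a \<Rightarrow> 'a)}"

end

theory Submission
  imports Defs "HOL-Computational_Algebra.Polynomial" "HOL-Analysis.Convex"
begin

text \<open>
  For an additive subgroup \<open>U\<close> of a field of characteristic 2 the polynomial
  \<open>L\<^sub>U(x) = \<Prod>\<^sub>u (x + u)\<close> is additive, and its logarithmic derivative shows that the inverses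
  of a coset \<open>x + U\<close> sum to \<open>c / L\<^sub>U(x)\<close>, where \<open>c\<close> is the product of the nonzero elements of \<open>U\<close>.
  Hence \<open>s(V) = s(U) + c s(L\<^sub>U(V))\<close> for \<open>U \<subseteq> V\<close>, where \<open>s\<close> is the sum of the inverses. It remains
  to find a \<open>k\<close>-dimensional \<open>V\<close> with \<open>s(V) = 0\<close>.

  With \<open>V\<close> the whole field this formula gives a duality \<open>k \<leftrightarrow> n - k\<close>, so that \<open>n \<ge> 2k\<close> may be assumed.
  It also gives additivity: zero-sum spaces of dimensions \<open>r\<close> and \<open>m\<close> yield one of dimension \<open>r + m\<close>
  as soon as \<open>r m < n\<close>, because then some multiple of the second space fits into the range of
  the polynomial of the first. A common divisor \<open>d \<ge> 2\<close> of \<open>k\<close> and \<open>n\<close> suffices as well: subspaces over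
  the field with \<open>2^d\<close> elements have sum 0. All this reduces the problem to \<open>k = 3, 4, 5\<close> and
  finitely many exceptional pairs.

  For \<open>k = 3, 4, 5\<close> and large \<open>n\<close> one needs a \<open>(k-1)\<close>-dimensional \<open>W\<close> with \<open>s(W) \<noteq> 0\<close> and \<open>s(W) W\<close> inside
  the kernel of the trace. By scaling, counting these spaces comes down to a single character sum,
  which in turn is an average of Kloosterman sums \<open>K(s(W'))\<close>. The elementary second moment
  of \<open>K\<close> and the Cauchy-Schwarz inequality suffice to bound it; for \<open>k = 3\<close> the only term is \<open>K(1)\<close>, and
  \<open>K(1)\<^sup>2\<close> is again an average of Kloosterman sums.
\<close>

section \<open>Additive subgroups and their inverse sums\<close>

text \<open>In characteristic 2 every element is its own negative, so this describes exactly the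
  additive subgroups, that is, the subspaces over the prime field.\<close>

definition add_closed :: "'a::field set \<Rightarrow> bool" where
  "add_closed V \<longleftrightarrow> 0 \<in> V \<and> (\<forall>x\<in>V. \<forall>y\<in>V. x + y \<in> V)"

text \<open>The element 0 contributes nothing because \<open>inverse 0 = 0\<close>; the sum is thus
  that of \<open>f_inv\<close>.\<close>

definition inv_sum :: "'a::field set \<Rightarrow> 'a" where
  "inv_sum V = (\<Sum>x\<in>V. inverse x)"

definition root_prod :: "'a::field set \<Rightarrow> 'a \<Rightarrow> 'a" where
  "root_prod U x = (\<Prod>u\<in>U. x + u)"

text \<open>For a subgroup \<open>U\<close> this is the linear coefficient of the polynomial
  \<open>root_prod U\<close>.\<close>

definition nz_prod :: "'a::field set \<Rightarrow> 'a" where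
  "nz_prod U = \<Prod>(U - {0})"

definition adjoin :: "'a::field set \<Rightarrow> 'a \<Rightarrow> 'a set" where
  "adjoin U z = U \<union> (\<lambda>u. u + z) ` U"

lemma inv_sum_scale:
  fixes c :: "'a::field"
  assumes "c \<noteq> 0"
  shows "inv_sum ((*) c ` V) = inverse c * inv_sum V"
proof -
  have "inj_on ((*) c) V" using assms by (auto intro: inj_onI)
  thus ?thesis
    by (simp add: inv_sum_def sum.reindex sum_distrib_left)
qed

lemma add_closed_scale: "add_closed V \<Longrightarrow> add_closed ((*) c ` V)"
  unfolding add_closed_def by (auto simp flip: distrib_left)

lemma add_closed_image:
  assumes "add_closed V" "\<And>x y. x \<in> V \<Longrightarrow> y \<in> V \<Longrightarrow> f (x + y) = f x + f y"
  shows "add_closed (f ` V)"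
proof -
  have "f (0 + 0) = f 0 + f 0" using assms unfolding add_closed_def by blast
  hence "f 0 = 0" by (metis add.right_neutral add_left_cancel)
  hence "0 \<in> f ` V" using assms(1) unfolding add_closed_def by (metis image_eqI)
  moreover have "f x + f y \<in> f ` V" if "x \<in> V" "y \<in> V" for x y
    using assms that unfolding add_closed_def by (metis image_eqI)
  ultimately show ?thesis unfolding add_closed_def by blast
qed

text \<open>Multiplication by \<open>x\<close> permutes the nonzero elements, so their product does
  not change when every factor is multiplied by \<open>x\<close>.\<close>

lemma finite_field_power_card_minus_1:
  fixes x :: "'a::{field,finite}"
  assumes "x \<noteq> 0"
  shows "x ^ (CARD('a) - 1) = 1"
proof -
  let ?P = "\<Prod>(UNIV - {0::'a})"
  have "(*) x ` (UNIV - {0}) = UNIV - {0}"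
  proof
    show "UNIV - {0} \<subseteq> (*) x ` (UNIV - {0})"
    proof
      fix y assume "y \<in> UNIV - {0::'a}"
      hence "y = x * (y / x)" "y / x \<in> UNIV - {0}" using assms by auto
      thus "y \<in> (*) x ` (UNIV - {0})" by blast
    qed
  qed (use assms in auto)
  moreover have "inj_on ((*) x) (UNIV - {0})" using assms by (auto intro: inj_onI)
  ultimately have "?P = (\<Prod>y\<in>UNIV - {0}. x * y)"
    by (metis (no_types, lifting) prod.reindex_cong)
  also have "\<dots> = x ^ (CARD('a) - 1) * ?P"
    by (simp add: prod.distrib card_Diff_singleton)
  finally show ?thesis by simp
qed

lemma finite_field_power_card:
  fixes x :: "'a::{field,finite}"
  shows "x ^ CARD('a) = x"
proof (cases "x = 0")
  case False
  have "x ^ CARD('a) = x ^ (CARD('a) - 1) * x"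
    by (subst power_Suc2[symmetric]) simp
  thus ?thesis using finite_field_power_card_minus_1[OF False] by simp
qed simp

lemma char2_of_card:
  assumes "CARD('a::{field,finite}) = 2 ^ n"
  shows "(1::'a) + 1 = 0"
proof -
  interpret V: vector_space "f2_scale :: bit \<Rightarrow> 'a \<Rightarrow> 'a"
    using vector_space_f2_scale assms .
  show ?thesis
    using V.scale_left_distrib[of 1 1 1] by (simp add: f2_scale_def)
qed

locale binary_field =
  fixes ty :: "'a::{field,finite} itself" and n :: nat
  assumes card_UNIV_eq: "CARD('a) = 2 ^ n"
begin

lemma add_self [simp]: "x + x = (0::'a)"
  using char2_of_card[OF card_UNIV_eq] by (metis distrib_left mult.right_neutral mult_zero_right)

lemma two_eq_0 [simp]: "(2::'a) = 0"
  using add_self[of 1] one_add_one by metis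

lemma add_self_left [simp]: "x + (x + y) = (y::'a)"
  by (simp flip: add.assoc)

lemma add_self_right [simp]: "y + x + x = (y::'a)"
  by (simp add: add.assoc)

lemma diff_eq_add: "x - y = x + (y::'a)"
  by (metis add_self_right diff_eq_eq)

lemma add_eq_0: "x + y = 0 \<longleftrightarrow> x = (y::'a)"
  by (metis add_self add_self_left add.right_neutral)

lemma square_add: "(x + y)\<^sup>2 = x\<^sup>2 + (y::'a)\<^sup>2"
proof -
  have "(x + y)\<^sup>2 = x\<^sup>2 + y\<^sup>2 + (x * y + x * y)" by (simp add: power2_eq_square algebra_simps)
  thus ?thesis by simp
qed

lemma power_card: "(x::'a) ^ 2 ^ n = x"
  using finite_field_power_card[of x] by (simp add: card_UNIV_eq)

lemma add_closed_UNIV: "add_closed (UNIV::'a set)"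
  by (simp add: add_closed_def)

lemma add_closed_0: "add_closed {0::'a}"
  by (simp add: add_closed_def)

lemma add_mem_iff: "add_closed (V::'a set) \<Longrightarrow> x \<in> V \<Longrightarrow> x + y \<in> V \<longleftrightarrow> y \<in> V"
  by (metis add_closed_def add_self_left)

lemma add_mem_iff': "add_closed (V::'a set) \<Longrightarrow> x \<in> V \<Longrightarrow> y + x \<in> V \<longleftrightarrow> y \<in> V"
  by (metis add_mem_iff add.commute)

lemma adjoin_disjoint: "add_closed U \<Longrightarrow> z \<notin> U \<Longrightarrow> U \<inter> (\<lambda>u. u + z) ` U = {}" for z :: 'a
  by (auto simp: add_mem_iff)

lemma card_adjoin:
  assumes "add_closed (U::'a set)" "z \<notin> U"
  shows "card (adjoin U z) = 2 * card U"
proof -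
  have "card ((\<lambda>u. u + z) ` U) = card U" by (rule card_image) simp
  thus ?thesis unfolding adjoin_def using adjoin_disjoint[OF assms]
    by (simp add: card_Un_disjoint)
qed

lemma add_closed_adjoin:
  assumes "add_closed (U::'a set)"
  shows "add_closed (adjoin U z)"
  unfolding add_closed_def
proof (intro conjI ballI)
  show "0 \<in> adjoin U z" using assms by (simp add: adjoin_def add_closed_def)
  fix x y assume "x \<in> adjoin U z" "y \<in> adjoin U z"
  then obtain u v where u: "u \<in> U" "x = u \<or> x = u + z" and v: "v \<in> U" "y = v \<or> y = v + z"
    by (auto simp: adjoin_def)
  have uv: "u + v \<in> U" using u v assms by (simp add: add_closed_def)
  have "x + y = u + v \<or> x + y = u + v + z"
    using u(2) v(2) by (auto simp: add_ac)
  thus "x + y \<in> adjoin U z" using uv by (auto simp: adjoin_def)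
qed

lemma mem_adjoin: "add_closed U \<Longrightarrow> z \<in> adjoin U (z::'a)"
  by (force simp: adjoin_def add_closed_def image_iff)

lemma adjoin_subset: "add_closed V \<Longrightarrow> U \<subseteq> V \<Longrightarrow> z \<in> V \<Longrightarrow> adjoin U z \<subseteq> (V::'a set)"
  by (auto simp: adjoin_def add_closed_def)

lemma adjoin_subset_iff:
  assumes "add_closed U" "add_closed V"
  shows "adjoin U z \<subseteq> V \<longleftrightarrow> U \<subseteq> V \<and> z \<in> (V::'a set)"
  using adjoin_subset[OF assms(2), of U z] mem_adjoin[OF assms(1), of z] unfolding adjoin_def by blast

text \<open>By finiteness there is a maximal subgroup of \<open>V\<close> that satisfies
  \<open>P\<close>; if it were proper, adjoining one more element would enlarge it.\<close>

lemma add_closed_induct [consumes 1, case_names zero adjoin]: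
  assumes V: "add_closed (V::'a set)"
    and zero: "P {0}"
    and step: "\<And>U z. add_closed U \<Longrightarrow> U \<subseteq> V \<Longrightarrow> z \<in> V \<Longrightarrow> z \<notin> U \<Longrightarrow> P U \<Longrightarrow> P (adjoin U z)"
  shows "P V"
proof -
  let ?S = "{U. add_closed U \<and> U \<subseteq> V \<and> P U}"
  have "{0} \<in> ?S" using zero V by (auto simp: add_closed_def)
  hence "?S \<noteq> {}" by blast
  then obtain U where U: "U \<in> ?S" and max: "\<And>U'. U' \<in> ?S \<Longrightarrow> U \<subseteq> U' \<Longrightarrow> U = U'"
    using finite_has_maximal[of ?S] by auto
  show ?thesis
  proof (cases "U = V")
    case False
    then obtain z where z: "z \<in> V" "z \<notin> U" using U by auto
    have "adjoin U z \<in> ?S"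
      using U z step[of U z] add_closed_adjoin[of U z] adjoin_subset[OF V] by auto
    hence "U = adjoin U z" by (rule max) (simp add: adjoin_def)
    thus ?thesis using mem_adjoin[of U z] U z by auto
  qed (use U in auto)
qed

lemma card_eq_power_2: "add_closed (V::'a set) \<Longrightarrow> \<exists>m. card V = 2 ^ m"
proof (induction rule: add_closed_induct)
  case zero
  show ?case by (rule exI[of _ 0]) simp
next
  case (adjoin U z)
  thus ?case using card_adjoin by (metis power_Suc)
qed

text \<open>All nonempty fibres are translates of the kernel.\<close>

lemma card_additive_image:
  fixes f :: "'a \<Rightarrow> 'a"
  assumes V: "add_closed V" and f: "\<And>x y. x \<in> V \<Longrightarrow> y \<in> V \<Longrightarrow> f (x + y) = f x + f y"
  shows "card V = card (f ` V) * card {x\<in>V. f x = 0}"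
proof -
  have "card {x\<in>V. f x = y} = card {x\<in>V. f x = 0}" if "y \<in> f ` V" for y
  proof -
    obtain x0 where x0: "x0 \<in> V" "y = f x0" using \<open>y \<in> f ` V\<close> by auto
    have "{x\<in>V. f x = y} = (\<lambda>x. x + x0) ` {x\<in>V. f x = 0}"
    proof (intro equalityI subsetI)
      fix x assume x: "x \<in> {x\<in>V. f x = y}"
      hence "x + x0 \<in> {x\<in>V. f x = 0}" using x0 V f by (auto simp: add_closed_def)
      thus "x \<in> (\<lambda>x. x + x0) ` {x\<in>V. f x = 0}"
        by (intro image_eqI[of _ _ "x + x0"]) auto
    qed (use x0 V f in \<open>auto simp: add_closed_def\<close>)
    thus ?thesis by (simp add: card_image)
  qed
  moreover have "card V = (\<Sum>y\<in>f ` V. card {x\<in>V. f x = y})"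
    using sum.image_gen[of V "\<lambda>_. 1::nat" f] by simp
  ultimately show ?thesis by simp
qed

section \<open>The polynomial of a subgroup and inverse sums over cosets\<close>

lemma root_prod_eq_0_iff: "root_prod U x = 0 \<longleftrightarrow> (x::'a) \<in> U"
  by (auto simp: root_prod_def add_eq_0)

lemma nz_prod_nonzero: "nz_prod (U::'a set) \<noteq> 0"
  by (simp add: nz_prod_def)

lemma root_prod_adjoin:
  assumes "add_closed (U::'a set)" "z \<notin> U"
  shows "root_prod (adjoin U z) x = root_prod U x * root_prod U (x + z)"
proof -
  have "(\<Prod>u\<in>(\<lambda>u. u + z) ` U. x + u) = root_prod U (x + z)"
    by (subst prod.reindex) (auto simp: root_prod_def add_ac)
  thus ?thesis unfolding adjoin_def
    using adjoin_disjoint[OF assms] by (simp add: root_prod_def prod.union_disjoint)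
qed

lemma nz_prod_adjoin:
  assumes "add_closed (U::'a set)" "z \<notin> U"
  shows "nz_prod (adjoin U z) = nz_prod U * root_prod U z"
proof -
  have "0 \<notin> (\<lambda>u. u + z) ` U" using assms by (auto simp: add_eq_0 add.commute)
  hence *: "adjoin U z - {0} = (U - {0}) \<union> (\<lambda>u. u + z) ` U" by (auto simp: adjoin_def)
  have "\<Prod>((\<lambda>u. u + z) ` U) = root_prod U z"
    by (subst prod.reindex) (auto simp: root_prod_def add_ac)
  moreover have "(U - {0}) \<inter> (\<lambda>u. u + z) ` U = {}" using adjoin_disjoint[OF assms] by blast
  ultimately show ?thesis unfolding nz_prod_def * by (simp add: prod.union_disjoint)
qed

lemma root_prod_add: "add_closed (U::'a set) \<Longrightarrow> root_prod U (x + y) = root_prod U x + root_prod U y"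
proof (induction arbitrary: x y rule: add_closed_induct)
  case zero
  show ?case by (simp add: root_prod_def)
next
  case (adjoin U z)
  \<comment> \<open>With L the polynomial of \<open>U\<close>, the next one is L(x)^2 + L(z) L(x),
    which is additive in x because squaring is.\<close>
  have *: "root_prod (adjoin U z) x = root_prod U x * root_prod U x + root_prod U x * root_prod U z" for x
    using adjoin by (simp add: root_prod_adjoin distrib_left)
  show ?case unfolding * adjoin(5)[of x y] using square_add[of "root_prod U x" "root_prod U y"]
    by (simp add: power2_eq_square algebra_simps)
qed

text \<open>The logarithmic derivative, obtained by induction instead of differentiation: a coset of
  \<open>adjoin U z\<close> splits into two cosets of \<open>U\<close>, whose sums combine by 1/a +
  1/(a+b) = b/(a(a+b)).\<close>

lemma sum_inverse_coset:
  "add_closed (U::'a set) \<Longrightarrow> x \<notin> U \<Longrightarrow> (\<Sum>u\<in>U. inverse (x + u)) = nz_prod U * inverse (root_prod U x)"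
proof (induction arbitrary: x rule: add_closed_induct)
  case zero
  show ?case by (simp add: root_prod_def nz_prod_def)
next
  case (adjoin U z)
  have x: "x \<notin> U" "x + z \<notin> U"
    using adjoin.prems adjoin.hyps(1) by (auto simp: adjoin_def image_iff)
  let ?R = "root_prod U"
  have nz: "?R x \<noteq> 0" "?R x + ?R z \<noteq> 0"
    using x adjoin.hyps(1) root_prod_eq_0_iff root_prod_add by metis+
  have "(\<Sum>u\<in>adjoin U z. inverse (x + u)) = (\<Sum>u\<in>U. inverse (x + u)) + (\<Sum>u\<in>(\<lambda>u. u + z) ` U. inverse (x + u))"
    unfolding adjoin_def using adjoin_disjoint[OF adjoin.hyps(1,4)] by (simp add: sum.union_disjoint)
  also have "(\<Sum>u\<in>(\<lambda>u. u + z) ` U. inverse (x + u)) = (\<Sum>u\<in>U. inverse (x + z + u))"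
    by (subst sum.reindex) (auto simp: add_ac)
  also have "(\<Sum>u\<in>U. inverse (x + u)) + \<dots>
      = nz_prod U * (inverse (?R x) + inverse (?R x + ?R z))"
    using x adjoin by (simp add: root_prod_add distrib_left)
  also have "inverse (?R x) + inverse (?R x + ?R z) = ?R z * inverse (?R x * (?R x + ?R z))"
    using nz by (simp add: divide_simps two_eq_0 flip: add.assoc)
  finally show ?case
    using adjoin by (simp add: nz_prod_adjoin root_prod_adjoin root_prod_add mult.assoc)
qed

lemma add_closed_root_prod_image: "add_closed (U::'a set) \<Longrightarrow> add_closed V \<Longrightarrow> add_closed (root_prod U ` V)"
  by (intro add_closed_image) (simp_all add: root_prod_add)

lemma card_root_prod_image:
  assumes "add_closed (U::'a set)" "add_closed V" "U \<subseteq> V"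
  shows "card V = card (root_prod U ` V) * card U"
proof -
  have "{x\<in>V. root_prod U x = 0} = U" using assms by (auto simp: root_prod_eq_0_iff)
  thus ?thesis using card_additive_image[OF assms(2), of "root_prod U"] root_prod_add[OF assms(1)]
    by simp
qed

text \<open>Group \<open>V\<close> by the fibres of \<open>root_prod U\<close>. The zero fibre is
  \<open>U\<close> itself, and every other fibre is a coset of \<open>U\<close>, summed by
  \<open>sum_inverse_coset\<close>.\<close>

lemma inv_sum_tower:
  assumes U: "add_closed (U::'a set)" and V: "add_closed V" and UV: "U \<subseteq> V"
  shows "inv_sum V = inv_sum U + nz_prod U * inv_sum (root_prod U ` V)"
proof -
  let ?L = "root_prod U" and ?W = "root_prod U ` V"
  have 0: "0 \<in> ?W" using add_closed_root_prod_image[OF U V] by (simp add: add_closed_def)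
  have fib0: "{x\<in>V. ?L x = 0} = U" using UV by (auto simp: root_prod_eq_0_iff)
  have fib: "(\<Sum>x | x \<in> V \<and> ?L x = y. inverse x) = nz_prod U * inverse y" if y: "y \<in> ?W - {0}" for y
  proof -
    obtain x0 where x0: "x0 \<in> V" "y = ?L x0" using y by auto
    have nU: "x0 \<notin> U" using y x0 by (auto simp: root_prod_eq_0_iff)
    have "{x. x \<in> V \<and> ?L x = y} = (\<lambda>u. x0 + u) ` U"
    proof (intro equalityI subsetI)
      fix x assume x: "x \<in> {x. x \<in> V \<and> ?L x = y}"
      hence "?L (x0 + x) = 0" using x0 U by (simp add: root_prod_add)
      hence "x0 + x \<in> U" by (simp add: root_prod_eq_0_iff)
      thus "x \<in> (\<lambda>u. x0 + u) ` U" by (intro image_eqI[of _ _ "x0 + x"]) auto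
    next
      fix x assume "x \<in> (\<lambda>u. x0 + u) ` U"
      then obtain u where u: "u \<in> U" "x = x0 + u" by auto
      have "?L u = 0" using u by (simp add: root_prod_eq_0_iff)
      thus "x \<in> {x. x \<in> V \<and> ?L x = y}" using u x0 UV U V by (auto simp: root_prod_add add_closed_def)
    qed
    thus ?thesis using sum_inverse_coset[OF U nU] x0 by (simp add: sum.reindex)
  qed
  have "inv_sum V = (\<Sum>y\<in>?W. \<Sum>x | x \<in> V \<and> ?L x = y. inverse x)"
    unfolding inv_sum_def by (rule sum.image_gen) simp
  also have "\<dots> = (\<Sum>x | x \<in> V \<and> ?L x = 0. inverse x) + (\<Sum>y\<in>?W - {0}. \<Sum>x | x \<in> V \<and> ?L x = y. inverse x)"
    by (rule sum.remove) (use 0 in auto)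
  also have "\<dots> = inv_sum U + (\<Sum>y\<in>?W - {0}. nz_prod U * inverse y)"
    using fib0 fib by (simp add: inv_sum_def)
  also have "(\<Sum>y\<in>?W - {0}. nz_prod U * inverse y) = nz_prod U * inv_sum ?W"
    using sum.remove[of ?W 0 inverse] 0 by (simp add: inv_sum_def sum_distrib_left)
  finally show ?thesis .
qed

text \<open>The witness is the preimage of \<open>W\<close> under \<open>root_prod U\<close>; as
  \<open>W\<close> lies in the range, the preimage maps onto all of \<open>W\<close>.\<close>

lemma ex_tower:
  assumes U: "add_closed (U::'a set)" and W: "add_closed W" and WR: "W \<subseteq> range (root_prod U)"
  shows "\<exists>V. add_closed V \<and> card V = card U * card W \<and> inv_sum V = inv_sum U + nz_prod U * inv_sum W"
proof -
  define V where "V = {x. root_prod U x \<in> W}"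
  have V: "add_closed V"
    using W root_prod_add[OF U] U unfolding V_def add_closed_def
    by (auto simp: root_prod_eq_0_iff[THEN iffD2])
  have UV: "U \<subseteq> V" using W by (auto simp: V_def root_prod_eq_0_iff[THEN iffD2] add_closed_def)
  have im: "root_prod U ` V = W" using WR by (auto simp: V_def)
  show ?thesis
    using V card_root_prod_image[OF U V UV] inv_sum_tower[OF U V UV] im by (auto simp: mult.commute)
qed

section \<open>Zero-sum subspaces: duality and additivity of dimensions\<close>

definition zero_sum_dim :: "nat \<Rightarrow> bool" where
  "zero_sum_dim k \<longleftrightarrow> (\<exists>V::'a set. add_closed V \<and> card V = 2 ^ k \<and> inv_sum V = 0)"

lemma scale_invariant_inv_sum:
  assumes "c \<noteq> 0" "c \<noteq> 1" "(*) c ` V = (V::'a set)"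
  shows "inv_sum V = 0"
proof -
  have "inv_sum V = inverse c * inv_sum V" using inv_sum_scale[OF assms(1), of V] assms(3) by simp
  hence "(1 - inverse c) * inv_sum V = 0" by (simp add: algebra_simps)
  thus ?thesis using assms by auto
qed

lemma inv_sum_UNIV:
  assumes "n \<ge> 2"
  shows "inv_sum (UNIV::'a set) = 0"
proof -
  have "card {0, 1::'a} < CARD('a)"
    unfolding card_UNIV_eq using power_increasing[OF assms, of "2::nat"] by simp
  hence "{0, 1::'a} \<noteq> UNIV" by (metis less_irrefl)
  then obtain c :: 'a where c: "c \<noteq> 0" "c \<noteq> 1" by auto
  have "(*) c ` UNIV = UNIV"
    using c by (auto intro!: range_eqI[of _ _ "_ / c"])
  thus ?thesis using scale_invariant_inv_sum[OF c] by blast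
qed

text \<open>In the tower formula from \<open>U\<close> up to the whole field two of the three sums
  vanish, so the range of \<open>root_prod U\<close> has inverse sum 0 as well.\<close>

lemma zero_sum_dim_dual:
  assumes "zero_sum_dim k" "k \<le> n" "n \<ge> 2"
  shows "zero_sum_dim (n - k)"
proof -
  obtain U :: "'a set" where U: "add_closed U" "card U = 2 ^ k" "inv_sum U = 0"
    using assms by (auto simp: zero_sum_dim_def)
  let ?H = "range (root_prod U)"
  have "2 ^ n = card ?H * 2 ^ k"
    using card_root_prod_image[OF U(1) add_closed_UNIV] U(2) card_UNIV_eq by simp
  also have "(2::nat) ^ n = 2 ^ (n - k) * 2 ^ k" using assms(2) by (simp flip: power_add)
  finally have "card ?H = 2 ^ (n - k)" by simp
  moreover have "inv_sum ?H = 0"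
    using inv_sum_tower[OF U(1) add_closed_UNIV] inv_sum_UNIV[OF assms(3)] U(3) nz_prod_nonzero[of U]
    by simp
  ultimately show ?thesis
    using add_closed_root_prod_image[OF U(1) add_closed_UNIV] by (auto simp: zero_sum_dim_def)
qed

text \<open>Codimensions are subadditive under intersection, in multiplicative form: addition on
  \<open>A \<times> B\<close> has fibres of at most \<open>card (A \<inter> B)\<close>
  elements.\<close>

lemma card_Int_ge:
  assumes A: "add_closed (A::'a set)" and B: "add_closed B"
  shows "card A * card B \<le> card (A \<inter> B) * 2 ^ n"
proof -
  let ?f = "\<lambda>(a, b). a + b :: 'a"
  have fib: "card {p \<in> A \<times> B. ?f p = y} \<le> card (A \<inter> B)" for y
  proof (cases "\<exists>a0\<in>A. \<exists>b0\<in>B. a0 + b0 = y")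
    case True
    then obtain a0 b0 where ab: "a0 \<in> A" "b0 \<in> B" "a0 + b0 = y" by blast
    have "{p \<in> A \<times> B. ?f p = y} \<subseteq> (\<lambda>c. (a0 + c, b0 + c)) ` (A \<inter> B)"
    proof
      fix p assume "p \<in> {p \<in> A \<times> B. ?f p = y}"
      then obtain a b where p: "p = (a, b)" "a \<in> A" "b \<in> B" "a + b = y" by auto
      have eq: "a0 + a = b0 + b" using p ab by (metis add.assoc add.commute add_self_left)
      have "a0 + a \<in> A" "b0 + b \<in> B" using p ab A B by (auto simp: add_closed_def)
      thus "p \<in> (\<lambda>c. (a0 + c, b0 + c)) ` (A \<inter> B)"
        using eq p by (intro image_eqI[of _ _ "a0 + a"]) (simp, metis add_self_left, metis IntI)
    qed
    thus ?thesis by (metis (no_types, lifting) card_image_le card_mono finite finite_imageI le_trans)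
  next
    case False
    hence "{p \<in> A \<times> B. ?f p = y} = {}" by auto
    thus ?thesis by (simp only: card.empty)
  qed
  have "card A * card B = card (A \<times> B)" by (simp add: card_cartesian_product)
  also have "\<dots> = (\<Sum>y\<in>?f ` (A \<times> B). card {p \<in> A \<times> B. ?f p = y})"
    using sum.image_gen[of "A \<times> B" "\<lambda>_. 1::nat" ?f] by simp
  also have "\<dots> \<le> (\<Sum>y\<in>?f ` (A \<times> B). card (A \<inter> B))" by (rule sum_mono) (rule fib)
  also have "\<dots> \<le> (\<Sum>y\<in>(UNIV::'a set). card (A \<inter> B))" by (rule sum_mono2) auto
  finally show ?thesis by (simp add: card_UNIV_eq mult.commute)
qed

text \<open>Each of the \<open>m\<close> generators z of \<open>W\<close> imposes one condition,
  that c z lie in \<open>H\<close>. Such a condition has codimension \<open>r\<close>, so together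
  they cost at most \<open>r * m\<close> dimensions.\<close>

lemma card_scalings_into:
  assumes H: "add_closed (H::'a set)" "card H * 2 ^ r = 2 ^ n" and W: "add_closed W" "card W = 2 ^ m"
  shows "card {c. \<forall>w\<in>W. c * w \<in> H} * 2 ^ (r * m) \<ge> 2 ^ n"
proof -
  let ?S = "\<lambda>W. {c. \<forall>w\<in>W. c * w \<in> H}"
  have cl: "add_closed (?S W)" for W
    using H(1) by (auto simp: add_closed_def distrib_right)
  have "\<forall>m. card W = 2 ^ m \<longrightarrow> card (?S W) * 2 ^ (r * m) \<ge> 2 ^ n"
    using W(1)
  proof (induction rule: add_closed_induct)
    case zero
    have S0: "?S {0} = UNIV" using H(1) by (auto simp: add_closed_def)
    show ?case unfolding S0 card_UNIV_eq by (metis mult.right_neutral mult_le_mono2 one_le_numeral one_le_power)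
  next
    case (adjoin U z)
    have z: "z \<noteq> 0" using adjoin by (auto simp: add_closed_def)
    have eq: "?S (adjoin U z) = ?S U \<inter> {c. c * z \<in> H}"
    proof (intro equalityI subsetI)
      fix c assume c: "c \<in> ?S U \<inter> {c. c * z \<in> H}"
      thus "c \<in> ?S (adjoin U z)" using H(1) by (auto simp: adjoin_def distrib_left add_closed_def)
    next
      fix c assume "c \<in> ?S (adjoin U z)"
      thus "c \<in> ?S U \<inter> {c. c * z \<in> H}" using mem_adjoin[OF adjoin(1), of z] by (auto simp: adjoin_def)
    qed
    have "add_closed {c. c * z \<in> H}" using H(1) by (auto simp: add_closed_def distrib_right)
    hence le: "card (?S U) * card {c. c * z \<in> H} \<le> card (?S (adjoin U z)) * 2 ^ n"
      unfolding eq by (rule card_Int_ge[OF cl])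
    have "{c. c * z \<in> H} = (\<lambda>h. h / z) ` H"
      using z by (auto simp: image_iff) (metis nonzero_mult_div_cancel_right)
    hence cH: "card {c. c * z \<in> H} = card H" using z by (simp add: card_image inj_on_def)
    show ?case
    proof (intro allI impI)
      fix m assume m: "card (adjoin U z) = 2 ^ m"
      obtain m' where m': "card U = 2 ^ m'" using card_eq_power_2 adjoin by blast
      have "2 ^ m = (2::nat) ^ Suc m'" using m m' adjoin card_adjoin by simp
      hence mm: "m = Suc m'" using power_inject_exp[of "2::nat" m "Suc m'"] by (metis one_less_numeral_iff semiring_norm(76))
      have IH: "2 ^ n \<le> card (?S U) * 2 ^ (r * m')" using adjoin m' by simp
      have "2 ^ n * 2 ^ n \<le> card (?S U) * 2 ^ (r * m') * (card H * 2 ^ r)"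
        unfolding H(2) using IH by simp
      also have "\<dots> = card (?S U) * card H * 2 ^ (r * m)"
        by (simp add: mm power_add algebra_simps)
      also have "\<dots> \<le> card (?S (adjoin U z)) * 2 ^ n * 2 ^ (r * m)"
        using le unfolding cH by (rule mult_right_mono) simp
      finally have "2 ^ n * 2 ^ n \<le> (card (?S (adjoin U z)) * 2 ^ (r * m)) * 2 ^ n"
        by (simp add: mult_ac)
      thus "2 ^ n \<le> card (?S (adjoin U z)) * 2 ^ (r * m)"
        by (subst (asm) mult_le_cancel2) simp
    qed
  qed
  thus ?thesis using W(2) by blast
qed

lemma zero_sum_dim_add:
  assumes "zero_sum_dim r" "zero_sum_dim m" "r * m < n"
  shows "zero_sum_dim (r + m)"
proof -
  obtain U W :: "'a set" where U: "add_closed U" "card U = 2 ^ r" "inv_sum U = 0"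
    and W: "add_closed W" "card W = 2 ^ m" "inv_sum W = 0"
    using assms by (auto simp: zero_sum_dim_def)
  let ?H = "range (root_prod U)" and ?S = "{c. \<forall>w\<in>W. c * w \<in> range (root_prod U)}"
  have H: "add_closed ?H" "card ?H * 2 ^ r = 2 ^ n"
    using add_closed_root_prod_image[OF U(1) add_closed_UNIV]
      card_root_prod_image[OF U(1) add_closed_UNIV] U(2) card_UNIV_eq by auto
  have "(2::nat) ^ (r * m) < 2 ^ n" using assms(3) by simp
  also have "\<dots> \<le> card ?S * 2 ^ (r * m)" by (rule card_scalings_into[OF H W(1,2)])
  \<comment> \<open>The strict inequality \<open>r * m < n\<close> leaves more than one admissible
    scalar, hence a nonzero one, and scaling by it keeps the inverse sum 0.\<close>
  finally have "\<not> ?S \<subseteq> {0}" using card_mono[of "{0}" ?S] by auto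
  then obtain c where c: "c \<noteq> 0" "(*) c ` W \<subseteq> ?H" by auto
  have "card ((*) c ` W) = 2 ^ m" using c W by (simp add: card_image inj_on_def)
  moreover have "inv_sum ((*) c ` W) = 0" using inv_sum_scale[OF c(1)] W by simp
  ultimately show ?thesis
    using ex_tower[OF U(1) add_closed_scale[OF W(1)] c(2)] U
    by (auto simp: zero_sum_dim_def power_add)
qed

lemma frobenius_power_add: "(x + y :: 'a) ^ 2 ^ d = x ^ 2 ^ d + y ^ 2 ^ d"
  by (induction d) (simp_all add: power_mult square_add mult.commute[of 2])

end

section \<open>Certificates by skew polynomials\<close>

text \<open>
  The kernel of \<open>L(x) = \<Sum>\<^sub>i a\<^sub>i x^(2^i)\<close> with \<open>a\<^sub>0 \<noteq> 0\<close> has inverse sum \<open>a\<^sub>1 / a\<^sub>0\<close>, and it lies in the field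
  with \<open>2^n\<close> elements iff \<open>M \<circ> L = x^(2^n) + x\<close> for some \<open>M\<close>. The coefficients of \<open>L\<close> and \<open>M\<close> live in
  \<open>\<bbbF>\<^sub>2[X]/(X^d + f)\<close> with \<open>d = length f\<close>, and are lists of bits, constant term first.
  That \<open>X^d + f\<close> splits over the field is checked by \<open>X^(2^n) = X\<close> modulo \<open>X^d + f\<close>.
\<close>

lemma dvd_power_diff: "(p::'a::comm_ring_1) dvd a - b \<Longrightarrow> p dvd a ^ m - b ^ m"
  by (simp add: power_diff_sumr2)

fun f2_add :: "bool list \<Rightarrow> bool list \<Rightarrow> bool list" where
  "f2_add [] q = q"
| "f2_add p [] = p"
| "f2_add (a # p) (b # q) = (a \<noteq> b) # f2_add p q"

text \<open>Multiplication by X. A list shorter than the modulus has room to grow; from a list of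
  full length the top bit is removed and, if set, replaced by \<open>f\<close>.\<close>

definition f2_shift :: "bool list \<Rightarrow> bool list \<Rightarrow> bool list" where
  "f2_shift f p = (if length p = length f \<and> p \<noteq> []
     then (if last p then f2_add (False # butlast p) f else False # butlast p) else False # p)"

fun f2_mul :: "bool list \<Rightarrow> bool list \<Rightarrow> bool list \<Rightarrow> bool list" where
  "f2_mul f [] q = []"
| "f2_mul f (a # p) q = (if a then f2_add q (f2_shift f (f2_mul f p q)) else f2_shift f (f2_mul f p q))"

definition f2_square :: "bool list \<Rightarrow> bool list \<Rightarrow> bool list" where
  "f2_square f p = f2_mul f p p"

text \<open>The accumulator keeps \<open>code_simp\<close> from duplicating unevaluated arguments,
  as it would for \<open>(f2_square f ^^ n) p\<close>.\<close>

fun f2_iter_square :: "bool list \<Rightarrow> nat \<Rightarrow> bool list \<Rightarrow> bool list" where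
  "f2_iter_square f 0 p = p"
| "f2_iter_square f (Suc n) p = f2_iter_square f n (f2_square f p)"

lemma f2_iter_square_eq: "f2_iter_square f n p = (f2_square f ^^ n) p"
  by (induction n arbitrary: p) (simp_all add: funpow_swap1)

fun skew_add :: "bool list list \<Rightarrow> bool list list \<Rightarrow> bool list list" where
  "skew_add [] q = q"
| "skew_add p [] = p"
| "skew_add (a # p) (b # q) = f2_add a b # skew_add p q"

text \<open>Composition of linearized polynomials: pulling the Frobenius map through
  \<open>L\<close> squares the coefficients of \<open>L\<close>.\<close>

fun skew_mul :: "bool list \<Rightarrow> bool list list \<Rightarrow> bool list list \<Rightarrow> bool list list" where
  "skew_mul f [] L = []"
| "skew_mul f (m # M) L = skew_add (map (f2_mul f m) L) ([] # skew_mul f M (map (f2_square f) L))"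

definition is_zero :: "bool list \<Rightarrow> bool" where
  "is_zero p \<longleftrightarrow> list_all Not p"

definition is_one :: "bool list \<Rightarrow> bool" where
  "is_one p \<longleftrightarrow> p \<noteq> [] \<and> hd p \<and> is_zero (tl p)"

text \<open>The product of the two constant coefficients is required to be 1, so that neither
  vanishes at any root of the modulus, which need not be irreducible. The entry \<open>L ! 1\<close>
  is the numerator of the inverse sum.\<close>

definition certificate :: "nat \<Rightarrow> bool list \<Rightarrow> bool list list \<Rightarrow> bool list list \<Rightarrow> bool" where
  "certificate n f L M \<longleftrightarrow>
     f \<noteq> [] \<and> is_zero (f2_add (f2_iter_square f n [False, True]) [False, True]) \<and>
     length L \<ge> 2 \<and> M \<noteq> [] \<and> length L + length M = n + 2 \<and>
     is_one (last L) \<and> is_one (last M) \<and> is_one (f2_mul f (hd M) (hd L)) \<and> is_zero (L ! 1) \<and>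
     (let R = skew_mul f M L in length R = n + 1 \<and> is_one (hd R) \<and> is_one (last R) \<and>
        list_all is_zero (butlast (tl R)))"

definition bits_eval :: "'a::comm_ring_1 \<Rightarrow> bool list \<Rightarrow> 'a" where
  "bits_eval t p = foldr (\<lambda>b acc. of_bool b + t * acc) p 0"

lemma bits_eval_Nil [simp]: "bits_eval t [] = 0"
  and bits_eval_Cons [simp]: "bits_eval t (b # p) = of_bool b + t * bits_eval t p"
  by (simp_all add: bits_eval_def)

lemma bits_eval_append: "bits_eval t (p @ q) = bits_eval t p + t ^ length p * bits_eval t q"
  by (induction p) (simp_all add: algebra_simps)

lemma bits_eval_is_zero: "is_zero p \<Longrightarrow> bits_eval t p = 0"
  by (induction p) (simp_all add: is_zero_def)

lemma bits_eval_is_one: "is_one p \<Longrightarrow> bits_eval t p = 1"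
  by (cases p) (simp_all add: is_one_def bits_eval_is_zero)

context
  fixes t :: "'a::comm_ring_1"
  assumes char2: "(1::'a) + 1 = 0"
begin

lemma bits_eval_add: "bits_eval t (f2_add p q) = bits_eval t p + bits_eval t q"
proof (induction p q rule: f2_add.induct)
  case (3 a p b q)
  have "of_bool (a \<noteq> b) = of_bool a + (of_bool b :: 'a)" using char2 by auto
  thus ?case using 3 by (simp add: algebra_simps del: of_bool_eq)
qed simp_all

text \<open>This and the next two facts are divisibilities rather than equations because
  \<open>t\<close> is later both a root, where the modulus vanishes, and the polynomial variable,
  when the existence of a root is shown.\<close>

lemma bits_eval_shift: "(t ^ length f + bits_eval t f) dvd (bits_eval t (f2_shift f p) - t * bits_eval t p)"
proof (cases "length p = length f \<and> p \<noteq> [] \<and> last p")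
  case True
  hence p: "p = butlast p @ [True]" by (metis append_butlast_last_id)
  have len: "Suc (length (butlast p)) = length f" using True by (metis length_append_singleton p)
  have "bits_eval t p = bits_eval t (butlast p) + t ^ length (butlast p)"
    by (subst p) (simp add: bits_eval_append)
  hence "t * bits_eval t p = t * bits_eval t (butlast p) + t ^ length f"
    by (simp add: len[symmetric] distrib_left)
  moreover have "bits_eval t (f2_shift f p) = t * bits_eval t (butlast p) + bits_eval t f"
    using True by (simp add: f2_shift_def bits_eval_add)
  moreover have "- (t ^ length f) = t ^ length f"
    using char2 by (metis add.commute distrib_left eq_neg_iff_add_eq_0 mult.right_neutral mult_zero_right)
  ultimately have "bits_eval t (f2_shift f p) - t * bits_eval t p = t ^ length f + bits_eval t f" by simp
  thus ?thesis by simp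
next
  case False
  show ?thesis
  proof (cases "length p = length f \<and> p \<noteq> []")
    case True
    hence p: "p = butlast p @ [False]" using False by (metis append_butlast_last_id)
    have "bits_eval t p = bits_eval t (butlast p)" by (subst p) (simp add: bits_eval_append)
    thus ?thesis using True False by (simp add: f2_shift_def)
  next
    case False
    hence "f2_shift f p = False # p" unfolding f2_shift_def by (rule if_not_P)
    thus ?thesis by simp
  qed
qed

lemma bits_eval_mul: "(t ^ length f + bits_eval t f) dvd (bits_eval t (f2_mul f p q) - bits_eval t p * bits_eval t q)"
proof (induction p)
  case (Cons a p)
  have "bits_eval t (f2_mul f (a # p) q) - bits_eval t (a # p) * bits_eval t q =
    (bits_eval t (f2_shift f (f2_mul f p q)) - t * bits_eval t (f2_mul f p q)) + t * (bits_eval t (f2_mul f p q) - bits_eval t p * bits_eval t q)"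
    by (simp add: bits_eval_add algebra_simps)
  thus ?case using Cons bits_eval_shift by (metis dvd_add dvd_mult)
qed simp

lemma bits_eval_iter_square:
  "(t ^ length f + bits_eval t f) dvd (bits_eval t (f2_iter_square f i [False, True]) - t ^ 2 ^ i)"
unfolding f2_iter_square_eq
proof (induction i)
  case (Suc i)
  let ?p = "(f2_square f ^^ i) [False, True]"
  have eq: "bits_eval t ((f2_square f ^^ Suc i) [False, True]) - t ^ 2 ^ Suc i =
      (bits_eval t (f2_mul f ?p ?p) - bits_eval t ?p * bits_eval t ?p) + ((bits_eval t ?p) ^ 2 - (t ^ 2 ^ i) ^ 2)"
    by (simp add: f2_square_def power2_eq_square mult_2 power_add)
  show ?case unfolding eq by (intro dvd_add bits_eval_mul dvd_power_diff Suc)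
qed simp

end

section \<open>Linearized polynomials and their roots\<close>

definition lin_poly :: "'a::field list \<Rightarrow> 'a poly" where
  "lin_poly as = (\<Sum>i<length as. monom (as ! i) (2 ^ i))"

definition lin_eval :: "'a::field list \<Rightarrow> 'a \<Rightarrow> 'a" where
  "lin_eval as x = (\<Sum>i<length as. as ! i * x ^ 2 ^ i)"

lemma poly_lin_poly: "poly (lin_poly as) x = lin_eval as x"
  by (simp add: lin_poly_def lin_eval_def poly_sum poly_monom)

lemma lin_eval_Nil [simp]: "lin_eval [] x = 0"
  by (simp add: lin_eval_def)

lemma lin_eval_Cons [simp]: "lin_eval (a # as) x = a * x + lin_eval as (x\<^sup>2)"
  by (simp add: lin_eval_def sum.lessThan_Suc_shift power_mult[symmetric] del: sum.lessThan_Suc)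

lemma lin_eval_append: "lin_eval (as @ bs) x = lin_eval as x + lin_eval bs (x ^ 2 ^ length as)"
  by (induction as arbitrary: x) (simp_all add: power_mult[symmetric] add.assoc)

lemma lin_eval_zeros: "list_all (\<lambda>a. a = 0) as \<Longrightarrow> lin_eval as x = 0"
  by (induction as arbitrary: x) simp_all

lemma coeff_lin_poly:
  "poly.coeff (lin_poly as) (2 ^ i) = (if i < length as then as ! i else 0)"
  by (simp add: lin_poly_def coeff_sum)

lemma degree_lin_poly_le: "degree (lin_poly as) \<le> 2 ^ (length as - 1)"
  unfolding lin_poly_def
  by (intro degree_sum_le order_trans[OF degree_monom_le] power_increasing) auto

lemma card_lin_eval_roots:
  fixes as :: "'a::{field,finite} list"
  assumes "as \<noteq> []" "last as \<noteq> 0"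
  shows "card {x. lin_eval as x = 0} \<le> 2 ^ (length as - 1)"
proof -
  have "poly.coeff (lin_poly as) (2 ^ (length as - 1)) \<noteq> 0"
    using assms by (simp add: coeff_lin_poly last_conv_nth)
  hence "lin_poly as \<noteq> 0" by auto
  from card_poly_roots_bound[OF this] show ?thesis
    using degree_lin_poly_le[of as] by (simp add: poly_lin_poly)
qed

text \<open>Only the lowest \<open>d\<close> bits are read, so the leading bit of a modulus of degree \<open>d\<close> is dropped.\<close>

primrec decode :: "nat \<Rightarrow> int \<Rightarrow> bool list" where
  "decode 0 m = []"
| "decode (Suc d) m = odd m # decode d (m div 2)"

lemma length_decode [simp]: "length (decode d m) = d"
  by (induction d arbitrary: m) simp_all

text \<open>
  Over \<open>\<bbbF>\<^sub>2\<close> itself, \<open>L\<close> and \<open>M\<close> amount to a factorization of the ordinary polynomial \<open>X^n + 1\<close>, and any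
  modulus serves; here it is \<open>X\<^sup>2 + X\<close>. For \<open>n = 23\<close> the factor \<open>L\<close> generates the binary Golay code.
  The coefficients in larger fields come from a computer search.
\<close>

lemma certificate_3_7: "certificate 7 [False, True] (map (\<lambda>b. [b, False]) (decode 4 0b1101)) (map (\<lambda>b. [b, False]) (decode 5 0b11101))"
  by code_simp

lemma certificate_4_9: "certificate 9 (decode 3 0b1011) (map (decode 3) [1,0,3,5,1]) (map (decode 3) [1, 0, 3, 5, 3, 1])"
  by code_simp

lemma certificate_12_25: "certificate 25 (decode 5 0b100101) (map (decode 5) [8,0,18,28,15,18,15,13,26,20,27,16,1]) (map (decode 5) [22,0,31,19,17,16,3,29,18,17,6,3,2,1])"
  by code_simp

lemma certificate_5_13: "certificate 13 (decode 13 0b10000000011011) (map (decode 13) [1,0,196,4468,264,1]) (map (decode 13) [1,0,196,4468,670,2346,3200,2464,1])"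
  by code_simp

lemma certificate_10_21: "certificate 21 [False, True] (map (\<lambda>b. [b, False]) (decode 11 0b10011010101)) (map (\<lambda>b. [b, False]) (decode 12 0b100110000101))"
  by code_simp

lemma certificate_11_23: "certificate 23 [False, True] (map (\<lambda>b. [b, False]) (decode 12 0b110001110101)) (map (\<lambda>b. [b, False]) (decode 13 0b1111100100101))"
  by code_simp

lemma certificate_11_24: "certificate 24 [False, True] (map (\<lambda>b. [b, False]) (decode 12 0b101101101101)) (map (\<lambda>b. [b, False]) (decode 14 0b10111111111101))"
  by code_simp

section \<open>Certificates and subfields as sources of zero-sum spaces\<close>

context binary_field
begin

text \<open>With cofactor g, every field element is a root of \<open>p\<close> or of g. Since the
  degrees add up to the size of the field, \<open>p\<close> must attain its maximal number of
  roots.\<close>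

lemma card_roots_of_dvd:
  fixes p :: "'a poly"
  assumes "p dvd monom 1 1 ^ 2 ^ n - monom 1 1" "n \<ge> 1"
  shows "card {x. poly p x = 0} = degree p"
proof -
  obtain g where g: "monom 1 1 ^ 2 ^ n - monom 1 1 = p * g" using assms(1) by auto
  have le: "(2::nat) ^ n > 1" using assms(2) by (metis one_less_numeral_iff one_less_power less_le_trans semiring_norm(76) zero_less_one less_numeral_extra(1) Suc_le_eq One_nat_def)
  have "degree (monom (1::'a) 1 ^ 2 ^ n - monom 1 1) = 2 ^ n"
    unfolding diff_conv_add_uminus monom_power
    by (subst degree_add_eq_left) (use le in \<open>simp_all add: degree_monom_eq\<close>)
  hence deg: "degree (p * g) = 2 ^ n" using g by metis
  hence nz: "p \<noteq> 0" "g \<noteq> 0" using le by auto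
  have "poly (p * g) x = 0" for x
    using power_card[of x] by (simp flip: g add: poly_monom)
  hence "(UNIV::'a set) = {x. poly p x = 0} \<union> {x. poly g x = 0}" by auto
  hence "2 ^ n \<le> card {x. poly p x = 0} + card {x. poly g x = 0}"
    using card_Un_le card_UNIV_eq by metis
  also have "\<dots> \<le> card {x. poly p x = 0} + degree g"
    using card_poly_roots_bound[OF nz(2)] by simp
  finally have "degree p \<le> card {x. poly p x = 0}" using deg nz by (simp add: degree_mult_eq)
  thus ?thesis using card_poly_roots_bound[OF nz(1)] by simp
qed

text \<open>The space is the kernel of \<open>L\<close>. The range of \<open>L\<close> consists of
  roots of \<open>M\<close>, which bounds it from above and hence the kernel from below; the degree
  of \<open>L\<close> bounds the kernel from above.\<close>

lemma zero_sum_dim_of_factorization: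
  fixes L M :: "'a list"
  assumes L: "length L \<ge> 2" "L ! 0 \<noteq> 0" "L ! 1 = 0" "last L \<noteq> 0"
    and M: "M \<noteq> []" "last M \<noteq> 0"
    and len: "length L + length M = n + 2"
    and comp_zero: "\<And>x. lin_eval M (lin_eval L x) = 0"
  shows "zero_sum_dim (length L - 1)"
proof -
  define k where "k = length L - 1"
  define V where "V = {x. lin_eval L x = 0}"
  have add: "lin_eval L (x + y) = lin_eval L x + lin_eval L y" for x y
    by (simp add: lin_eval_def frobenius_power_add algebra_simps sum.distrib)
  have 0: "lin_eval L 0 = 0" unfolding lin_eval_def by (rule sum.neutral) auto
  have V: "add_closed V" by (auto simp: V_def add_closed_def add 0)
  have "card (UNIV::'a set) = card (range (lin_eval L)) * card V"
    using card_additive_image[OF add_closed_UNIV, of "lin_eval L"] add by (simp add: V_def)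
  also have "card (range (lin_eval L)) \<le> card {x. lin_eval M x = 0}"
    by (intro card_mono) (auto simp: comp_zero)
  hence "card (range (lin_eval L)) * card V \<le> 2 ^ (length M - 1) * card V"
    using card_lin_eval_roots[OF M] by (meson le_trans mult_le_mono1)
  finally have "2 ^ n \<le> 2 ^ (length M - 1) * card V" by (simp add: card_UNIV_eq)
  moreover have "length M - 1 + k = n"
    using len L(1) M(1) by (cases M) (simp_all add: k_def)
  hence "(2::nat) ^ n = 2 ^ (length M - 1) * 2 ^ k"
    by (simp flip: power_add)
  ultimately have "2 ^ k \<le> card V" by simp
  moreover have "card V \<le> 2 ^ k"
    unfolding V_def k_def using L by (intro card_lin_eval_roots) auto
  ultimately have cV: "card V = 2 ^ k" by simp
  define Q where "Q = (\<Prod>v\<in>V - {0}. [:v, 1:])"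
  have V0: "0 \<in> V" using V by (simp add: add_closed_def)
  \<comment> \<open>Both sides have degree at most \<open>2 ^ k\<close>, share the coefficient in
    that degree and vanish at the \<open>2 ^ k\<close> elements of \<open>V\<close>.\<close>
  have "lin_poly L = Polynomial.smult (last L) (\<Prod>v\<in>V. [:v, 1:])"
  proof (rule poly_eqI_degree_lead_coeff[where A = V and n = "2 ^ k"])
    have mon: "lead_coeff (\<Prod>v\<in>V. [:v, 1:]) = 1" by (simp add: lead_coeff_prod)
    have deg: "degree (\<Prod>v\<in>V. [:v, 1:]) = 2 ^ k"
      by (subst degree_prod_eq_sum_degree) (simp_all add: cV)
    show "poly.coeff (lin_poly L) (2 ^ k) = poly.coeff (Polynomial.smult (last L) (\<Prod>v\<in>V. [:v, 1:])) (2 ^ k)"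
      using mon deg L by (cases "L = []") (auto simp: coeff_lin_poly k_def last_conv_nth)
    show "degree (lin_poly L) \<le> 2 ^ k" unfolding k_def by (rule degree_lin_poly_le)
    show "degree (Polynomial.smult (last L) (\<Prod>v\<in>V. [:v, 1:])) \<le> 2 ^ k"
      using deg degree_smult_le by metis
    show "poly (lin_poly L) z = poly (Polynomial.smult (last L) (\<Prod>v\<in>V. [:v, 1:])) z" if "z \<in> V" for z
    proof -
      have "poly (\<Prod>v\<in>V. [:v, 1:]) z = 0"
        using that by (auto simp: poly_prod intro!: bexI[of _ z])
      thus ?thesis using that by (simp add: poly_lin_poly V_def)
    qed
  qed (simp add: cV)
  also have "(\<Prod>v\<in>V. [:v, 1:]) = [:0, 1:] * Q"
    unfolding Q_def using V0 by (simp add: prod.remove)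
  finally have eq: "lin_poly L = Polynomial.smult (last L) ([:0, 1:] * Q)" .
  \<comment> \<open>Entry 1 of \<open>L\<close> belongs to X^2. Once the factor X is removed it is,
    up to the leading coefficient, the linear coefficient of \<open>Q\<close>, which is
    \<open>nz_prod V * inv_sum V\<close>.\<close>
  have "poly.coeff (lin_poly L) (2 ^ 1) = 0" unfolding coeff_lin_poly using L by simp
  hence "poly.coeff Q 1 = 0" using L(4) unfolding eq by (simp add: numeral_2_eq_2)
  hence "poly (pderiv Q) 0 = 0" by (simp add: poly_0_coeff_0 coeff_pderiv)
  also have "poly (pderiv Q) 0 = (\<Sum>v\<in>V - {0}. \<Prod>(V - {0} - {v}))"
    unfolding Q_def pderiv_prod by (simp add: poly_sum poly_prod pderiv_pCons)
  also have "\<dots> = (\<Sum>v\<in>V - {0}. nz_prod V * inverse v)"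
    by (intro sum.cong refl) (auto simp: nz_prod_def prod_diff1 field_simps)
  also have "\<dots> = nz_prod V * (\<Sum>v\<in>V - {0}. inverse v)" by (simp add: sum_distrib_left)
  also have "(\<Sum>v\<in>V - {0}. inverse v) = inv_sum V"
    unfolding inv_sum_def using V0 by (simp add: sum.remove)
  finally have "inv_sum V = 0" using nz_prod_nonzero[of V] by simp
  thus ?thesis using V cV unfolding zero_sum_dim_def k_def by blast
qed

lemma char2_poly: "(1::'a poly) + 1 = 0"
  using char2_of_card[OF card_UNIV_eq] by (simp add: one_pCons)

text \<open>The squaring test says that the modulus divides X^(2^n) - X, so all its roots lie in the
  field.\<close>

lemma root_of_iter_square:
  assumes f: "f \<noteq> []" "is_zero (f2_add (f2_iter_square f n [False, True]) [False, True])" and n: "n \<ge> 1"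
  obtains t :: 'a where "t ^ length f + bits_eval t f = 0"
proof -
  define X :: "'a poly" where "X = monom 1 1"
  define p where "p = X ^ length f + bits_eval X f"
  have evp: "poly (bits_eval X g) t = bits_eval t g" for t g
    by (induction g) (simp_all add: X_def poly_monom)
  have deg_ev: "degree (bits_eval X g) < length g \<or> bits_eval X g = 0" for g
  proof (induction g)
    case (Cons b g)
    have "X * q = pCons 0 q" for q :: "'a poly" by (simp add: X_def monom_altdef)
    hence "degree (bits_eval X (b # g)) \<le> Suc (degree (bits_eval X g))"
      by (simp add: degree_add_le degree_pCons_le)
    thus ?case using Cons by (cases b) auto
  qed simp
  have "degree (bits_eval X f) < length f" using deg_ev[of f] f(1) by auto
  hence deg: "degree p = length f"
    unfolding p_def X_def monom_power by (subst degree_add_eq_left) (simp_all add: degree_monom_eq)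
  let ?r = "f2_iter_square f n [False, True]"
  have "bits_eval X ?r + X = 0"
    using bits_eval_is_zero[OF f(2), of X] by (simp add: bits_eval_add[OF char2_poly])
  moreover have "X + X = (1 + 1) * X" by (simp only: distrib_right mult_1_left)
  hence "X + X = 0" using char2_poly by simp
  ultimately have "bits_eval X ?r = X" by (metis add_right_cancel)
  hence "p dvd X - X ^ 2 ^ n"
    using bits_eval_iter_square[OF char2_poly, of X f n] by (simp add: p_def)
  hence "p dvd X ^ 2 ^ n - X" by (metis dvd_minus_iff minus_diff_eq)
  from card_roots_of_dvd[OF this[unfolded X_def] n] deg f(1)
  have "{x. poly p x = 0} \<noteq> {}" by (metis card.empty length_0_conv)
  then obtain t where "poly p t = 0" by auto
  moreover have "poly p t = t ^ length f + bits_eval t f"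
    by (simp add: p_def evp) (simp add: X_def poly_monom)
  ultimately have "t ^ length f + bits_eval t f = 0" by simp
  thus ?thesis by (rule that)
qed

text \<open>Evaluating all bit lists at a root of the modulus turns the certificate into a
  factorization over the field. The separate \<open>m\<close> lets a certificate for a numeral be
  inserted directly.\<close>

lemma zero_sum_dim_certificate:
  assumes "certificate m f L M" "m = n" "n \<ge> 1" "length L = Suc k"
  shows "zero_sum_dim k"
proof -
  have c: "certificate n f L M" and n: "n \<ge> 1" using assms by auto
  have certificate_4_9: "(1::'a) + 1 = 0" using char2_of_card[OF card_UNIV_eq] .
  obtain t :: 'a where t: "t ^ length f + bits_eval t f = 0"
    using c n by (auto simp: certificate_def intro: root_of_iter_square[of f])
  have mul: "bits_eval t (f2_mul f p q) = bits_eval t p * bits_eval t q" for p q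
    using bits_eval_mul[OF certificate_4_9, of t f p q] unfolding t by simp
  let ?e = "map (bits_eval t)"
  have add: "lin_eval (?e (skew_add P Q)) x = lin_eval (?e P) x + lin_eval (?e Q) x" for P Q x
    by (induction P Q arbitrary: x rule: skew_add.induct) (simp_all add: bits_eval_add[OF certificate_4_9] algebra_simps)
  have scale: "lin_eval (?e (map (f2_mul f m) P)) x = bits_eval t m * lin_eval (?e P) x" for m P x
    by (induction P arbitrary: x) (simp_all add: mul algebra_simps)
  have square: "lin_eval (?e (map (f2_square f) P)) (x\<^sup>2) = (lin_eval (?e P) x)\<^sup>2" for P x
  proof (induction P arbitrary: x)
    case (Cons a P)
    show ?case using Cons[of "x\<^sup>2"]
      by (simp add: f2_square_def mul square_add power_mult_distrib power2_eq_square[of "bits_eval t a"])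
  qed simp
  have comp: "lin_eval (?e (skew_mul f P Q)) x = lin_eval (?e P) (lin_eval (?e Q) x)" for P Q x
  proof (induction P arbitrary: Q x)
    case (Cons m P)
    thus ?case by (simp add: add scale square del: map_map)
  qed simp
  define R where "R = skew_mul f M L"
  have R: "length R = n + 1" "is_one (hd R)" "is_one (last R)" "list_all is_zero (butlast (tl R))"
    using c by (auto simp: certificate_def R_def Let_def)
  have Rsplit: "R = hd R # butlast (tl R) @ [last R]"
  proof -
    have "R \<noteq> []" "tl R \<noteq> []" using R(1) n by (auto simp flip: length_greater_0_conv)
    thus ?thesis by (metis append_butlast_last_id last_tl list.collapse)
  qed
  have lenR: "length (butlast (tl R)) = n - 1" using R by simp
  have "lin_eval (?e R) x = 0" for x
  proof -
    have z: "lin_eval (?e (butlast (tl R))) y = 0" for y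
      using R(4) by (intro lin_eval_zeros) (auto simp: list_all_iff bits_eval_is_zero)
    have "lin_eval (?e R) x = x + (x\<^sup>2) ^ 2 ^ (n - 1)"
      by (subst Rsplit) (simp add: lin_eval_append z bits_eval_is_one R lenR del: length_butlast)
    also have "(x\<^sup>2) ^ 2 ^ (n - 1) = x ^ 2 ^ n"
      using n by (simp flip: power_mult power_Suc)
    finally show ?thesis by (simp add: power_card)
  qed
  hence comp_zero: "lin_eval (?e M) (lin_eval (?e L) x) = 0" for x by (simp add: comp R_def)
  have L: "length L \<ge> 2" "M \<noteq> []" "length L + length M = n + 2" "is_one (last L)" "is_one (last M)"
    "is_one (f2_mul f (hd M) (hd L))" "is_zero (L ! 1)"
    using c by (auto simp: certificate_def)
  have "L \<noteq> []" using L(1) by auto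
  have "bits_eval t (hd M) * bits_eval t (hd L) = 1" using bits_eval_is_one[OF L(6), of t] by (simp add: mul)
  hence "?e L ! 0 \<noteq> 0" using \<open>L \<noteq> []\<close> by (auto simp: hd_conv_nth)
  moreover have "?e L ! 1 = 0" using L by (simp add: bits_eval_is_zero)
  moreover have "last (?e L) \<noteq> 0" "last (?e M) \<noteq> 0"
    using L \<open>L \<noteq> []\<close> by (simp_all add: last_map bits_eval_is_one)
  ultimately show ?thesis
    using zero_sum_dim_of_factorization[of "?e L" "?e M"] L comp_zero assms(4) by simp
qed

text \<open>\<open>E\<close> is the subfield with \<open>2 ^ d\<close> elements. A space over
  \<open>E\<close> is grown one \<open>E\<close>-line at a time; it is invariant under scaling by
  some c in \<open>E\<close> other than 0 and 1, which forces sum 0.\<close>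

lemma zero_sum_dim_of_common_divisor:
  assumes d: "d \<ge> 2" "d dvd n" "d dvd k" and k: "k \<le> n" and n: "n \<ge> 1"
  shows "zero_sum_dim k"
proof -
  define E where "E = {x::'a. x ^ 2 ^ d = x}"
  let ?X = "monom (1::'a) 1"
  let ?p = "?X ^ 2 ^ d - ?X"
  have d2: "(2::nat) ^ d > 1" using d(1) by (intro one_less_power) auto
  obtain m where m: "n = d * m" using d(2) by auto
  have "?p dvd ?X ^ 2 ^ (d * i) - ?X" for i
  proof (induction i)
    case (Suc i)
    have "?X ^ 2 ^ (d * Suc i) - ?X = ((?X ^ 2 ^ (d * i)) ^ 2 ^ d - ?X ^ 2 ^ d) + ?p"
      by (simp add: power_add mult.commute flip: power_mult)
    thus ?case using dvd_add[OF dvd_power_diff[OF Suc, of "2 ^ d"] dvd_refl] by simp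
  qed simp
  hence "?p dvd ?X ^ 2 ^ n - ?X" unfolding m .
  from card_roots_of_dvd[OF this n] have "card {x. poly ?p x = 0} = degree ?p" .
  also have "degree ?p = 2 ^ d"
    unfolding diff_conv_add_uminus monom_power
    by (subst degree_add_eq_left) (use d2 in \<open>simp_all add: degree_monom_eq\<close>)
  also have "{x. poly ?p x = 0} = E" by (auto simp: E_def poly_monom)
  finally have cE: "card E = 2 ^ d" .
  have E_add: "x + y \<in> E" if "x \<in> E" "y \<in> E" for x y
    using that by (simp add: E_def frobenius_power_add)
  have E_div: "x / y \<in> E" if "x \<in> E" "y \<in> E" for x y
    using that by (simp add: E_def power_divide)
  have E_mult: "x * y \<in> E" if "x \<in> E" "y \<in> E" for x y
    using that by (simp add: E_def power_mult_distrib)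
  have E01: "0 \<in> E" "1 \<in> E" by (auto simp: E_def)
  have ex: "\<exists>V. add_closed V \<and> card V = 2 ^ (d * j) \<and> (\<forall>e\<in>E. \<forall>v\<in>V. e * v \<in> V)" if "j \<le> m" for j
    using that
  proof (induction j)
    case 0
    show ?case by (rule exI[of _ "{0}"]) (simp add: add_closed_def)
  next
    case (Suc j)
    then obtain V where V: "add_closed V" "card V = 2 ^ (d * j)" and EV: "\<And>e v. e \<in> E \<Longrightarrow> v \<in> V \<Longrightarrow> e * v \<in> V"
      by auto
    have "d * j < n" using Suc.prems d(1) by (simp add: m)
    hence "card V < card (UNIV::'a set)" using V(2) by (simp add: card_UNIV_eq)
    then obtain z where z: "z \<notin> V" by (metis UNIV_eq_I less_irrefl)
    let ?f = "\<lambda>(v, e). v + e * z" and ?V = "(\<lambda>(v, e). v + e * z) ` (V \<times> E)"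
    have "inj_on ?f (V \<times> E)"
    proof (rule inj_onI)
      fix p q assume p: "p \<in> V \<times> E" and q: "q \<in> V \<times> E" and pq: "?f p = ?f q"
      obtain v e v' e' where [simp]: "p = (v, e)" "q = (v', e')" by (cases p; cases q)
      have vv: "v + v' = (e + e') * z"
      proof -
        have "v + v' + (e + e') * z = (v + e * z) + (v' + e' * z)" by (simp add: algebra_simps)
        also have "\<dots> = 0" using pq by (simp add: add_eq_0)
        finally show ?thesis by (simp add: add_eq_0)
      qed
      \<comment> \<open>Otherwise \<open>z\<close> would be an \<open>E\<close>-multiple of
        \<open>v + v'\<close> and so lie in \<open>V\<close>.\<close>
      have "e = e'"
      proof (rule ccontr)
        assume "e \<noteq> e'"
        hence "z = 1 / (e + e') * (v + v')" using vv by (simp add: add_eq_0)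
        moreover have "1 / (e + e') \<in> E" using p q E01 E_add E_div by auto
        moreover have "v + v' \<in> V" using p q V by (simp add: add_closed_def)
        ultimately show False using z EV by metis
      qed
      thus "p = q" using pq by simp
    qed
    hence "card ?V = 2 ^ (d * Suc j)"
      by (simp add: card_image card_cartesian_product V(2) cE power_add)
    moreover have "add_closed ?V"
      unfolding add_closed_def
    proof (intro conjI ballI)
      show "0 \<in> ?V" using V(1) E01 by (intro image_eqI[of _ _ "(0, 0)"]) (auto simp: add_closed_def)
      fix x y assume "x \<in> ?V" "y \<in> ?V"
      then obtain v e v' e' where "v \<in> V" "e \<in> E" "v' \<in> V" "e' \<in> E" "x = v + e * z" "y = v' + e' * z" by auto
      thus "x + y \<in> ?V" using V(1) E_add
        by (intro image_eqI[of _ _ "(v + v', e + e')"]) (auto simp: add_closed_def algebra_simps)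
    qed
    moreover have "c * w \<in> ?V" if c: "c \<in> E" and w: "w \<in> ?V" for c w
    proof -
      obtain v e where "v \<in> V" "e \<in> E" "w = v + e * z" using w by auto
      thus ?thesis using EV[OF c] E_mult[OF c]
        by (intro image_eqI[of _ _ "(c * v, c * e)"]) (auto simp: distrib_left mult.assoc)
    qed
    ultimately show ?case by blast
  qed
  obtain j where j: "k = d * j" using d(3) by auto
  have "j \<le> m" using k d(1) by (simp add: j m)
  from ex[OF this] obtain V where V: "add_closed V" "card V = 2 ^ k" "\<forall>e\<in>E. \<forall>v\<in>V. e * v \<in> V"
    by (auto simp: j)
  have "card {0, 1::'a} < card E"
    unfolding cE using power_increasing[OF d(1), of "2::nat"] by simp
  hence "\<not> E \<subseteq> {0, 1}" by (metis card_mono finite not_less)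
  then obtain c where c: "c \<in> E" "c \<noteq> 0" "c \<noteq> 1" by auto
  have "(*) c ` V = V"
    by (rule card_subset_eq) (use c V in \<open>auto simp: card_image inj_on_def\<close>)
  hence "inv_sum V = 0" using scale_invariant_inv_sum c by blast
  thus ?thesis using V by (auto simp: zero_sum_dim_def)
qed

section \<open>The additive character and Kloosterman sums\<close>

text \<open>By the additive form of Hilbert 90 this is the kernel of the absolute trace. Defined as
  an image, it has index 2 because the map has kernel {0, 1}.\<close>

definition trace_zero :: "'a set" where
  "trace_zero = range (\<lambda>y. y\<^sup>2 + y)"

text \<open>The canonical additive character, -1 to the power of the trace.\<close>

definition chi :: "'a \<Rightarrow> real" where
  "chi x = (if x \<in> trace_zero then 1 else - 1)"

abbreviation q :: real where
  "q \<equiv> 2 ^ n"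

lemma root_prod_01: "root_prod {0, 1} x = x\<^sup>2 + (x::'a)"
  by (simp add: root_prod_def power2_eq_square algebra_simps)

lemma add_closed_01: "add_closed {0, 1::'a}"
  by (auto simp: add_closed_def)

lemma range_root_prod_01: "range (root_prod {0, 1}) = trace_zero"
  by (simp add: trace_zero_def root_prod_01[abs_def])

lemma inv_sum_01: "inv_sum {0, 1::'a} = 1"
  by (simp add: inv_sum_def)

lemma nz_prod_01: "nz_prod {0, 1::'a} = 1"
proof -
  have "{0, 1::'a} - {0} = {1}" by auto
  thus ?thesis by (simp add: nz_prod_def)
qed

lemma add_closed_trace_zero: "add_closed trace_zero"
  using add_closed_root_prod_image[OF add_closed_01 add_closed_UNIV]
  by (simp add: range_root_prod_01)

lemma card_trace_zero: "card trace_zero * 2 = CARD('a)"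
  using card_root_prod_image[OF add_closed_01 add_closed_UNIV] by (simp add: range_root_prod_01)

lemma add_mem_trace_zero: "x \<notin> trace_zero \<Longrightarrow> y \<notin> trace_zero \<Longrightarrow> x + y \<in> trace_zero"
proof -
  assume x: "x \<notin> trace_zero" and y: "y \<notin> trace_zero"
  have "adjoin trace_zero x = UNIV"
    by (rule card_subset_eq) (use card_adjoin[OF add_closed_trace_zero x] card_trace_zero in simp_all)
  hence "y \<in> adjoin trace_zero x" by simp
  then obtain u where u: "u \<in> trace_zero" "y = u + x" using y by (auto simp: adjoin_def)
  have "x + y = u" using u(2) by (simp only: add.commute[of u] add_self_left)
  thus ?thesis using u(1) by (simp only:)
qed

lemma chi_add: "chi (x + y) = chi x * chi y"
  using add_mem_trace_zero[of x y] add_mem_iff[OF add_closed_trace_zero, of x y] add_mem_iff'[OF add_closed_trace_zero, of y x]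
  by (auto simp: chi_def)

lemma chi_0 [simp]: "chi 0 = 1"
  using add_closed_trace_zero by (simp add: chi_def add_closed_def)

lemma chi_abs [simp]: "\<bar>chi x\<bar> = 1"
  by (simp add: chi_def)

lemma sum_chi_subgroup:
  assumes W: "add_closed (W::'a set)" and f: "\<And>x y. f (x + y) = f x + f y"
  shows "(\<Sum>w\<in>W. chi (f w)) = (if \<forall>w\<in>W. f w \<in> trace_zero then real (card W) else 0)"
proof (cases "\<forall>w\<in>W. f w \<in> trace_zero")
  case True
  thus ?thesis by (simp add: chi_def)
next
  case False
  then obtain z where z: "z \<in> W" "f z \<notin> trace_zero" by blast
  \<comment> \<open>Translation by \<open>z\<close> permutes \<open>W\<close> but changes the sign
    of every term, so the sum is its own negative.\<close>
  have "(\<Sum>w\<in>W. chi (f w)) = (\<Sum>w\<in>W. chi (f (z + w)))"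
    by (rule sum.reindex_bij_witness[of _ "(+) z" "(+) z"]) (use W z in \<open>auto simp: add_closed_def\<close>)
  also have "\<dots> = (\<Sum>w\<in>W. - chi (f w))"
    by (intro sum.cong refl) (simp add: f chi_add, use z in \<open>simp add: chi_def\<close>)
  finally have "(\<Sum>w\<in>W. chi (f w)) = 0" by (simp add: sum_negf)
  thus ?thesis using False by (simp only: if_False)
qed

lemma sum_chi_mult: "(\<Sum>x\<in>UNIV. chi (c * x)) = (if c = 0 then q else 0)"
proof (cases "c = 0")
  case True
  thus ?thesis by (simp add: card_UNIV_eq)
next
  case False
  have "card trace_zero \<noteq> CARD('a)" using card_trace_zero by (metis finite_UNIV_card_ge_0 finite mult.commute mult_2 add_cancel_left_left less_irrefl)
  hence "trace_zero \<noteq> UNIV" by auto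
  then obtain y where y: "y \<notin> trace_zero" by auto
  have "c * (y / c) \<notin> trace_zero" using y False by simp
  hence "\<not> (\<forall>x\<in>UNIV. c * x \<in> trace_zero)" by blast
  thus ?thesis using sum_chi_subgroup[OF add_closed_UNIV, of "(*) c"] False
    by (simp add: distrib_left)
qed

lemma sum_chi_nonzero: "c \<noteq> 0 \<Longrightarrow> (\<Sum>x\<in>-{0}. chi (c * x)) = - 1"
  using sum_chi_mult[of c] sum.remove[of UNIV 0 "\<lambda>x. chi (c * x)"] by (simp add: Compl_eq_Diff_UNIV)

lemma sum_divide_nonzero: "(\<Sum>w\<in>-{0}. g (c / w)) = (\<Sum>w\<in>-{0}. g (c * w))" for c :: 'a
  by (rule sum.reindex_bij_witness[of _ inverse inverse]) (auto simp: field_simps)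

text \<open>The term at 0 is left out, so \<open>kloosterman 0\<close> is -1.\<close>

definition kloosterman :: "'a \<Rightarrow> real" where
  "kloosterman a = (\<Sum>x\<in>-{0}. chi (x + a / x))"

lemma card_nonzero: "real (card (-{0::'a})) = q - 1"
proof -
  have "card (-{0::'a}) = 2 ^ n - 1"
    by (simp add: Compl_eq_Diff_UNIV card_Diff_singleton card_UNIV_eq)
  thus ?thesis by (simp add: of_nat_diff)
qed

text \<open>Expand the square and sum over \<open>a\<close> first: orthogonality leaves only the
  pairs with x = y.\<close>

lemma sum_kloosterman_sq: "(\<Sum>a\<in>UNIV. (kloosterman a)\<^sup>2) = q * (q - 1)"
proof -
  have "(\<Sum>a\<in>UNIV. (kloosterman a)\<^sup>2)
      = (\<Sum>a\<in>UNIV. \<Sum>x\<in>-{0}. \<Sum>y\<in>-{0}. chi (x + y) * chi ((inverse x + inverse y) * a))"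
    unfolding kloosterman_def power2_eq_square sum_product
    by (intro sum.cong refl) (simp add: chi_add[symmetric] field_simps del: mult_minus_left)
  also have "\<dots> = (\<Sum>x\<in>-{0}. \<Sum>y\<in>-{0}. \<Sum>a\<in>UNIV. chi (x + y) * chi ((inverse x + inverse y) * a))"
    by (simp only: sum.swap[of _ _ "UNIV :: 'a set"])
  also have "\<dots> = (\<Sum>x\<in>-{0::'a}. \<Sum>y\<in>-{0}. if x = y then q else 0)"
    by (rule sum.cong[OF refl], rule sum.cong[OF refl])
      (simp add: sum_distrib_left[symmetric] sum_chi_mult add_eq_0)
  also have "\<dots> = (\<Sum>x\<in>-{0::'a}. q)"
    by (intro sum.cong refl) simp
  finally show ?thesis using card_nonzero by simp
qed

text \<open>Cauchy-Schwarz, followed by the full second moment in which every value of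
  \<open>g\<close> is charged at most \<open>m\<close> times.\<close>

lemma sum_kloosterman_bound:
  fixes g :: "'b \<Rightarrow> 'a"
  assumes S: "finite S" and fib: "\<And>c. card {s\<in>S. g s = c} \<le> m"
  shows "(\<Sum>s\<in>S. kloosterman (g s))\<^sup>2 \<le> real (card S) * real m * (q * (q - 1))"
proof -
  have "(\<Sum>s\<in>S. (kloosterman (g s))\<^sup>2) = (\<Sum>c\<in>g ` S. \<Sum>s | s \<in> S \<and> g s = c. (kloosterman (g s))\<^sup>2)"
    by (rule sum.image_gen[OF S])
  also have "\<dots> = (\<Sum>c\<in>g ` S. real (card {s\<in>S. g s = c}) * (kloosterman c)\<^sup>2)"
    by (intro sum.cong refl) simp
  also have "\<dots> \<le> (\<Sum>c\<in>g ` S. real m * (kloosterman c)\<^sup>2)"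
    by (intro sum_mono mult_right_mono) (use fib in auto)
  also have "\<dots> \<le> (\<Sum>c\<in>UNIV. real m * (kloosterman c)\<^sup>2)"
    by (intro sum_mono2) auto
  also have "\<dots> = real m * (q * (q - 1))"
    by (simp add: sum_distrib_left[symmetric] sum_kloosterman_sq)
  finally have "(\<Sum>s\<in>S. (kloosterman (g s))\<^sup>2) * real (card S) \<le> real m * (q * (q - 1)) * real (card S)"
    by (rule mult_right_mono) simp
  thus ?thesis
    using order_trans[OF sum_squared_le_sum_of_squares] by (simp add: mult_ac)
qed

lemma sum_scale_nonzero: "c \<noteq> 0 \<Longrightarrow> (\<Sum>x\<in>-{0}. g x) = (\<Sum>x\<in>-{0}. g (x / c))" for c :: 'a
  by (rule sum.reindex_bij_witness[of _ "\<lambda>x. x / c" "\<lambda>x. x * c"]) auto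

text \<open>In the double sum put y = u x. The case u = 1 gives only ones; otherwise replacing x by
  x/(u+1) turns the argument into x + (u + 1/u)/x.\<close>

lemma kloosterman_1_sq:
  "(kloosterman 1)\<^sup>2 = q - 1 + (\<Sum>u\<in>-{0,1}. kloosterman (u + inverse u))"
proof -
  have "(kloosterman 1)\<^sup>2 = (\<Sum>x\<in>-{0}. \<Sum>y\<in>-{0}. chi (x + inverse x + (y + inverse y)))"
    unfolding kloosterman_def power2_eq_square sum_product
    by (simp add: chi_add inverse_eq_divide)
  also have "\<dots> = (\<Sum>x\<in>-{0}. \<Sum>u\<in>-{0}. chi (x + inverse x + (u * x + inverse (u * x))))"
  proof (rule sum.cong[OF refl])
    fix x :: 'a assume x: "x \<in> -{0}"
    show "(\<Sum>y\<in>-{0}. chi (x + inverse x + (y + inverse y))) =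
        (\<Sum>u\<in>-{0}. chi (x + inverse x + (u * x + inverse (u * x))))"
      by (rule sum.reindex_bij_witness[of _ "\<lambda>u. u * x" "\<lambda>y. y / x"]) (use x in auto)
  qed
  also have "\<dots> = (\<Sum>u\<in>-{0}. \<Sum>x\<in>-{0}. chi (x + inverse x + (u * x + inverse (u * x))))"
    by (rule sum.swap)
  also have "\<dots> = (\<Sum>x\<in>-{0::'a}. 1) + (\<Sum>u\<in>-{0} - {1}. \<Sum>x\<in>-{0}. chi (x + inverse x + (u * x + inverse (u * x))))"
    by (subst sum.remove[of _ 1]) auto
  also have "(\<Sum>x\<in>-{0::'a}. 1) = q - 1" using card_nonzero by simp
  also have "-{0} - {1} = -{0, 1::'a}" by auto
  also have "(\<Sum>u\<in>-{0,1}. \<Sum>x\<in>-{0}. chi (x + inverse x + (u * x + inverse (u * x))))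
     = (\<Sum>u\<in>-{0,1}. kloosterman (u + inverse u))"
  proof (intro sum.cong refl)
    fix u :: 'a assume u: "u \<in> -{0,1}"
    hence nz: "u \<noteq> 0" "u + 1 \<noteq> 0" by (auto simp: add_eq_0)
    have "(\<Sum>x\<in>-{0}. chi (x + inverse x + (u * x + inverse (u * x))))
       = (\<Sum>x\<in>-{0}. chi (x / (u + 1) + inverse (x / (u + 1)) + (u * (x / (u + 1)) + inverse (u * (x / (u + 1))))))"
      by (rule sum_scale_nonzero[OF nz(2)])
    also have "\<dots> = (\<Sum>x\<in>-{0}. chi (x + (u + inverse u) / x))"
    proof (rule sum.cong[OF refl], rule arg_cong[of _ _ chi])
      fix x :: 'a assume x: "x \<in> -{0}"
      have "x / (u + 1) + u * (x / (u + 1)) = (u + 1) * (x / (u + 1))"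
        by (simp only: distrib_right mult_1_left add.commute)
      hence 1: "x / (u + 1) + u * (x / (u + 1)) = x" using nz by simp
      have "inverse (x / (u + 1)) + inverse (u * (x / (u + 1))) = (u + 1) * (u + 1) / (u * x)"
        using nz x by (simp add: field_simps)
      also have "(u + 1) * (u + 1) = u * u + 1"
        using square_add[of u 1] by (simp add: power2_eq_square)
      also have "(u * u + 1) / (u * x) = (u + inverse u) / x"
        using nz x by (simp add: field_simps)
      finally have 2: "inverse (x / (u + 1)) + inverse (u * (x / (u + 1))) = (u + inverse u) / x" .
      have "x / (u + 1) + inverse (x / (u + 1)) + (u * (x / (u + 1)) + inverse (u * (x / (u + 1))))
         = (x / (u + 1) + u * (x / (u + 1))) + (inverse (x / (u + 1)) + inverse (u * (x / (u + 1))))"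
        by (simp only: add_ac)
      thus "x / (u + 1) + inverse (x / (u + 1)) + (u * (x / (u + 1)) + inverse (u * (x / (u + 1)))) = x + (u + inverse u) / x"
        unfolding 1 2 .
    qed
    finally show "(\<Sum>x\<in>-{0}. chi (x + inverse x + (u * x + inverse (u * x)))) = kloosterman (u + inverse u)"
      by (simp add: kloosterman_def)
  qed
  finally show ?thesis .
qed

lemma card_add_inverse_fibre: "card {u\<in>-{0,1}. u + inverse u = (c::'a)} \<le> 2"
proof -
  have "{u\<in>-{0,1}. u + inverse u = c} \<subseteq> {x. poly [:1, c, 1:] x = 0}"
  proof
    fix u assume u: "u \<in> {u\<in>-{0,1}. u + inverse u = c}"
    hence "c * u = u * u + 1" by (auto simp: field_simps)
    moreover have "poly [:1, c, 1:] u = c * u + (u * u + 1)" by (simp add: algebra_simps)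
    ultimately show "u \<in> {x. poly [:1, c, 1:] x = 0}" by (simp only: mem_Collect_eq add_self)
  qed
  hence "card {u\<in>-{0,1}. u + inverse u = c} \<le> card {x. poly [:1, c, 1:] x = 0}"
    by (intro card_mono) auto
  also have "\<dots> \<le> degree [:1, c, 1:]" by (rule card_poly_roots_bound) simp
  finally show ?thesis by simp
qed

lemma kloosterman_1_bound:
  assumes "n \<ge> 8"
  shows "\<bar>kloosterman 1\<bar> \<le> (q - 14) / 3"
proof -
  let ?S = "\<Sum>u\<in>-{0,1::'a}. kloosterman (u + inverse u)"
  have q: "q \<ge> 256" using power_increasing[OF assms, of "2::real"] by simp
  have cS: "real (card (-{0,1::'a})) \<le> q"
    using of_nat_mono[OF card_mono[of UNIV "-{0,1::'a}"], where 'a = real] by (simp add: card_UNIV_eq)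
  have "?S\<^sup>2 \<le> real (card (-{0,1::'a})) * real 2 * (q * (q - 1))"
    by (rule sum_kloosterman_bound) (use card_add_inverse_fibre in auto)
  also have "\<dots> \<le> q * 2 * (q * q)"
    using cS q by (intro mult_mono) auto
  also have "\<dots> \<le> (q * (q / 22 + 11))\<^sup>2"
  proof -
    \<comment> \<open>A linear bound for the square root of 2q, sharp at q = 242, just below the
      smallest case q = 256.\<close>
    have "0 \<le> (q / 22 - 11)\<^sup>2" by simp
    hence "2 * q \<le> (q / 22 + 11)\<^sup>2" by (simp add: power2_eq_square algebra_simps)
    hence "q\<^sup>2 * (2 * q) \<le> q\<^sup>2 * (q / 22 + 11)\<^sup>2" by (rule mult_left_mono) simp
    thus ?thesis by (simp add: power_mult_distrib power2_eq_square mult_ac)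
  qed
  finally have "?S \<le> q * (q / 22 + 11)"
    by (rule power2_le_imp_le) (use q in simp)
  hence "(kloosterman 1)\<^sup>2 \<le> q - 1 + q * (q / 22 + 11)" unfolding kloosterman_1_sq by simp
  also have "\<dots> \<le> ((q - 14) / 3)\<^sup>2"
  proof -
    have "0 \<le> (q - 256) * (q * (13 / 198) + 1)" using q by (intro mult_nonneg_nonneg) auto
    thus ?thesis using q by (simp add: power2_eq_square field_simps)
  qed
  finally show ?thesis using q by (simp add: abs_le_square_iff[of "kloosterman 1" "(q - 14) / 3", symmetric] abs_le_iff)
qed

section \<open>Averages over subspaces\<close>

definition subspaces :: "nat \<Rightarrow> 'a set set" where
  "subspaces d = {W. add_closed W \<and> card W = 2 ^ d}"

definition subspaces_over :: "'a set \<Rightarrow> nat \<Rightarrow> 'a set set" where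
  "subspaces_over U d = {W \<in> subspaces d. U \<subseteq> W}"

text \<open>\<open>ext_sum m g U\<close> sums \<open>g\<close> over all ways to enlarge \<open>U\<close> by \<open>m\<close> successive generators;
  every subspace over \<open>U\<close> of the right size arises \<open>ext_count m (dim U)\<close> times.\<close>

primrec ext_sum :: "nat \<Rightarrow> ('a set \<Rightarrow> real) \<Rightarrow> 'a set \<Rightarrow> real" where
  "ext_sum 0 g U = g U"
| "ext_sum (Suc m) g U = (\<Sum>z\<in>-U. ext_sum m g (adjoin U z))"

primrec ext_count :: "nat \<Rightarrow> nat \<Rightarrow> real" where
  "ext_count 0 e = 1"
| "ext_count (Suc m) e = (2 ^ (e + Suc m) - 2 ^ e) * ext_count m (Suc e)"

lemma ext_count_pos: "ext_count m e > 0"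
proof (induction m arbitrary: e)
  case (Suc m)
  have "(2::real) ^ e < 2 ^ (e + Suc m)" by (rule power_strict_increasing) auto
  thus ?case using Suc by simp
qed simp

text \<open>Double counting of the pairs of a space \<open>W\<close> and a first generator in
  \<open>W - U\<close>; the size of that difference is the factor in
  \<open>ext_count\<close>.\<close>

lemma ext_sum_eq:
  assumes "add_closed U" "card U = 2 ^ e"
  shows "ext_sum m g U = ext_count m e * (\<Sum>W\<in>subspaces_over U (e + m). g W)"
  using assms
proof (induction m arbitrary: U e)
  case 0
  have "subspaces_over U e = {U}"
    using 0 by (auto simp: subspaces_over_def subspaces_def) (metis card_subset_eq finite)
  thus ?case by simp
next
  case (Suc m)
  let ?S = "subspaces_over U (e + Suc m)"
  have "ext_sum (Suc m) g U = (\<Sum>z\<in>-U. ext_count m (Suc e) * (\<Sum>W\<in>subspaces_over (adjoin U z) (Suc e + m). g W))"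
    unfolding ext_sum.simps
    by (rule sum.cong[OF refl], rule Suc.IH) (use Suc.prems in \<open>auto simp: add_closed_adjoin card_adjoin\<close>)
  also have "\<dots> = ext_count m (Suc e) * (\<Sum>z\<in>-U. \<Sum>W | W \<in> ?S \<and> z \<in> W. g W)"
    unfolding sum_distrib_left[symmetric]
    by (intro arg_cong2[of _ _ _ _ "(*)"] refl sum.cong)
      (auto simp: subspaces_over_def subspaces_def adjoin_subset_iff Suc.prems
        dest: adjoin_subset[THEN subsetD, rotated -1])
  also have "(\<Sum>z\<in>-U. \<Sum>W | W \<in> ?S \<and> z \<in> W. g W) = (\<Sum>W\<in>?S. \<Sum>z | z \<in> -U \<and> z \<in> W. g W)"
    by (rule sum.swap_restrict) auto
  also have "\<dots> = (\<Sum>W\<in>?S. (2 ^ (e + Suc m) - 2 ^ e) * g W)"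
  proof (rule sum.cong[OF refl])
    fix W assume W: "W \<in> ?S"
    have "{z. z \<in> -U \<and> z \<in> W} = W - U" by auto
    moreover have "card (W - U) = 2 ^ (e + Suc m) - 2 ^ e"
      using W Suc.prems by (subst card_Diff_subset) (auto simp: subspaces_over_def subspaces_def)
    moreover have "(2::nat) ^ e \<le> 2 ^ (e + Suc m)" by (intro power_increasing) auto
    ultimately show "(\<Sum>z | z \<in> -U \<and> z \<in> W. g W) = (2 ^ (e + Suc m) - 2 ^ e) * g W"
      by (simp add: of_nat_diff)
  qed
  finally show ?case
    unfolding sum_distrib_left[symmetric] ext_count.simps by (simp only: mult_ac)
qed

text \<open>The recursion adds the first generator; estimates need the last one, with everything
  before it fixed.\<close>

lemma ext_sum_last:
  "ext_sum (Suc m) g U = ext_sum m (\<lambda>V. \<Sum>z\<in>-V. g (adjoin V z)) U"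
  by (induction m arbitrary: U) simp_all

lemma ext_sum_mono:
  assumes "add_closed U" "card U = 2 ^ e"
    and "\<And>V. V \<in> subspaces_over U (e + m) \<Longrightarrow> g V \<le> h V"
  shows "ext_sum m g U \<le> ext_sum m h U"
  unfolding ext_sum_eq[OF assms(1,2)] using ext_count_pos[of m e]
  by (intro mult_left_mono sum_mono assms(3)) auto

lemma card_complement:
  assumes "card (V::'a set) = 2 ^ e"
  shows "real (card (-V)) = q - 2 ^ e"
proof -
  have "card (-V) = 2 ^ n - 2 ^ e"
    using assms by (simp add: Compl_eq_Diff_UNIV card_Diff_subset card_UNIV_eq)
  moreover have "2 ^ e \<le> (2::nat) ^ n" using assms card_mono[of UNIV V] by (simp add: card_UNIV_eq)
  ultimately show ?thesis by (simp add: of_nat_diff)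
qed

lemma ext_sum_one:
  assumes "add_closed U" "card U = 2 ^ e"
  shows "ext_sum m (\<lambda>_. 1) U = (\<Prod>i<m. q - 2 ^ (e + i))"
  using assms
proof (induction m arbitrary: U e)
  case (Suc m)
  have "ext_sum (Suc m) (\<lambda>_. 1) U = (\<Sum>z\<in>-U. \<Prod>i<m. q - 2 ^ (Suc e + i))"
    unfolding ext_sum.simps
    by (rule sum.cong[OF refl], rule Suc.IH) (use Suc.prems in \<open>auto simp: add_closed_adjoin card_adjoin\<close>)
  also have "\<dots> = (q - 2 ^ e) * (\<Prod>i<m. q - 2 ^ (Suc e + i))"
    using card_complement[OF Suc.prems(2)] by simp
  also have "\<dots> = (\<Prod>i<Suc m. q - 2 ^ (e + i))"
    by (simp add: prod.lessThan_Suc_shift del: prod.lessThan_Suc)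
  finally show ?case .
qed simp

lemma card_subspaces_over:
  assumes "add_closed U" "card U = 2 ^ e"
  shows "real (card (subspaces_over U (e + m))) = (\<Prod>i<m. q - 2 ^ (e + i)) / ext_count m e"
  using ext_sum_eq[OF assms, of m "\<lambda>_. 1"] ext_sum_one[OF assms, of m] ext_count_pos[of m e]
  by (simp add: field_simps)

text \<open>If for every fixed \<open>V\<close> the mean over the last generator is at most
  \<open>R\<close>, then so is the mean over all spaces.\<close>

lemma sum_subspaces_over_le:
  assumes U: "add_closed U" "card U = 2 ^ e" and q: "2 ^ (e + m) < q"
    and step: "\<And>V. V \<in> subspaces_over U (e + m) \<Longrightarrow> (\<Sum>z\<in>-V. g (adjoin V z)) \<le> R * (q - 2 ^ (e + m))"
  shows "(\<Sum>W\<in>subspaces_over U (e + Suc m). g W) \<le> R * real (card (subspaces_over U (e + Suc m)))"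
proof -
  let ?c = "ext_count (Suc m) e"
  have "?c * (\<Sum>W\<in>subspaces_over U (e + Suc m). g W) = ext_sum m (\<lambda>V. \<Sum>z\<in>-V. g (adjoin V z)) U"
    using ext_sum_eq[OF U, of "Suc m" g] ext_sum_last by metis
  also have "\<dots> \<le> ext_sum m (\<lambda>V. R * (q - 2 ^ (e + m))) U"
    by (rule ext_sum_mono[OF U step])
  also have "\<dots> = R * ext_sum m (\<lambda>V. \<Sum>z\<in>-V. 1) U"
    unfolding ext_sum_eq[OF U] sum_distrib_left
    by (intro sum.cong refl) (simp add: card_complement subspaces_over_def subspaces_def)
  also have "\<dots> = R * ext_sum (Suc m) (\<lambda>_. 1) U" by (simp only: ext_sum_last)
  also have "\<dots> = ?c * (R * real (card (subspaces_over U (e + Suc m))))"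
    by (simp add: ext_sum_eq[OF U] del: ext_sum.simps ext_count.simps)
  finally show ?thesis using ext_count_pos[of "Suc m" e] by (simp del: ext_count.simps)
qed

lemma inv_sum_adjoin:
  assumes "add_closed V" "z \<notin> V"
  shows "inv_sum (adjoin V z) = inv_sum V + nz_prod V * inverse (root_prod V (z::'a))"
proof -
  have "root_prod V ` adjoin V z = {0, root_prod V z}"
  proof -
    have "root_prod V ` V = {0}"
      using assms(1) by (auto simp: root_prod_eq_0_iff[THEN iffD2] add_closed_def image_iff)
    moreover have "root_prod V ` (\<lambda>u. u + z) ` V = {root_prod V z}"
      using assms(1) by (auto simp: root_prod_add root_prod_eq_0_iff[THEN iffD2] add_closed_def image_iff)
    ultimately show ?thesis by (simp add: adjoin_def image_Un insert_commute)
  qed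
  moreover have "root_prod V z \<noteq> 0" using assms root_prod_eq_0_iff by blast
  ultimately have "inv_sum (root_prod V ` adjoin V z) = inverse (root_prod V z)"
    by (simp add: inv_sum_def)
  thus ?thesis
    using inv_sum_tower[OF assms(1) add_closed_adjoin[OF assms(1), of z]] by (simp add: adjoin_def)
qed

text \<open>By \<open>inv_sum_adjoin\<close> the value determines \<open>root_prod V z\<close>,
  hence \<open>z\<close> modulo \<open>V\<close>.\<close>

lemma card_inv_sum_adjoin_fibre:
  assumes V: "add_closed (V::'a set)"
  shows "card {z\<in>-V. inv_sum (adjoin V z) = c} \<le> card V"
proof (cases "{z\<in>-V. inv_sum (adjoin V z) = c} = {}")
  case False
  then obtain z0 where z0: "z0 \<notin> V" "inv_sum (adjoin V z0) = c" by auto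
  have "{z\<in>-V. inv_sum (adjoin V z) = c} \<subseteq> (\<lambda>v. v + z0) ` V"
  proof
    fix z assume "z \<in> {z\<in>-V. inv_sum (adjoin V z) = c}"
    hence z: "z \<notin> V" "inv_sum (adjoin V z) = inv_sum (adjoin V z0)" using z0 by auto
    hence "root_prod V z = root_prod V z0"
      using V z0(1) nz_prod_nonzero[of V] by (simp add: inv_sum_adjoin)
    hence "root_prod V (z + z0) = 0" using V by (simp add: root_prod_add)
    hence "z + z0 \<in> V" by (simp add: root_prod_eq_0_iff)
    thus "z \<in> (\<lambda>v. v + z0) ` V" by (intro image_eqI[of _ _ "z + z0"]) auto
  qed
  thus ?thesis by (meson card_image_le finite card_mono finite_imageI le_trans)
qed (simp only: card.empty)

lemma card_zero_sum_subspaces_le: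
  assumes U: "add_closed U" "card U = 2 ^ e" and q: "2 ^ (e + m) < q"
  shows "real (card {W\<in>subspaces_over U (e + Suc m). inv_sum W = 0})
    \<le> 2 ^ (e + m) / (q - 2 ^ (e + m)) * real (card (subspaces_over U (e + Suc m)))"
proof -
  let ?g = "\<lambda>W::'a set. if inv_sum W = 0 then 1 else 0 :: real"
  have "(\<Sum>W\<in>subspaces_over U (e + Suc m). ?g W)
      \<le> 2 ^ (e + m) / (q - 2 ^ (e + m)) * real (card (subspaces_over U (e + Suc m)))"
  proof (rule sum_subspaces_over_le[OF U q])
    fix V assume V: "V \<in> subspaces_over U (e + m)"
    have "(\<Sum>z\<in>-V. ?g (adjoin V z)) = real (card {z\<in>-V. inv_sum (adjoin V z) = 0})"
      by (simp add: sum.If_cases Int_def)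
    also have "\<dots> \<le> 2 ^ (e + m)"
      using card_inv_sum_adjoin_fibre[of V 0] V
      by (simp add: subspaces_over_def subspaces_def)
    finally show "(\<Sum>z\<in>-V. ?g (adjoin V z)) \<le> 2 ^ (e + m) / (q - 2 ^ (e + m)) * (q - 2 ^ (e + m))"
      using q by simp
  qed
  thus ?thesis by (simp add: sum.If_cases Int_def)
qed

text \<open>For fixed \<open>V\<close>, no value \<open>inv_sum (adjoin V z)\<close> occurs more
  than \<open>card V\<close> times, so \<open>sum_kloosterman_bound\<close> applies; the condition
  on \<open>R\<close> makes the resulting mean over \<open>z\<close> at most \<open>R\<close>. Both
  signs are treated to get the absolute value.\<close>

lemma sum_kloosterman_subspaces_le:
  assumes U: "add_closed U" "card U = 2 ^ e" and q: "2 ^ (e + m) < q"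
    and R: "R \<ge> 0" "2 ^ (e + m) * (q * (q - 1)) \<le> R\<^sup>2 * (q - 2 ^ (e + m))"
  shows "\<bar>\<Sum>W\<in>subspaces_over U (e + Suc m). kloosterman (inv_sum W)\<bar>
    \<le> R * real (card (subspaces_over U (e + Suc m)))"
proof -
  have *: "\<bar>\<Sum>z\<in>-V. kloosterman (inv_sum (adjoin V z))\<bar> \<le> R * (q - 2 ^ (e + m))"
    if V: "V \<in> subspaces_over U (e + m)" for V
  proof -
    have cV: "add_closed V" "card V = 2 ^ (e + m)" using V by (auto simp: subspaces_over_def subspaces_def)
    have "(\<Sum>z\<in>-V. kloosterman (inv_sum (adjoin V z)))\<^sup>2 \<le> real (card (-V)) * real (2 ^ (e + m)) * (q * (q - 1))"
      by (rule sum_kloosterman_bound) (use card_inv_sum_adjoin_fibre[OF cV(1)] cV(2) in auto)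
    also have "\<dots> = (q - 2 ^ (e + m)) * (2 ^ (e + m) * (q * (q - 1)))"
      by (simp add: card_complement[OF cV(2)])
    also have "\<dots> \<le> (q - 2 ^ (e + m)) * (R\<^sup>2 * (q - 2 ^ (e + m)))"
      by (rule mult_left_mono[OF R(2)]) (use q in simp)
    also have "\<dots> = (R * (q - 2 ^ (e + m)))\<^sup>2"
      by (simp only: power2_eq_square mult_ac)
    finally have "\<bar>\<Sum>z\<in>-V. kloosterman (inv_sum (adjoin V z))\<bar> \<le> \<bar>R * (q - 2 ^ (e + m))\<bar>"
      by (simp only: abs_le_square_iff)
    thus ?thesis using R(1) q by (simp add: abs_mult)
  qed
  have "(\<Sum>W\<in>subspaces_over U (e + Suc m). kloosterman (inv_sum W)) \<le> R * real (card (subspaces_over U (e + Suc m)))"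
    by (rule sum_subspaces_over_le[OF U q]) (use * in force)
  moreover have "(\<Sum>W\<in>subspaces_over U (e + Suc m). - kloosterman (inv_sum W)) \<le> R * real (card (subspaces_over U (e + Suc m)))"
    by (rule sum_subspaces_over_le[OF U q]) (use * in \<open>force simp: sum_negf\<close>)
  ultimately show ?thesis by (simp add: sum_negf abs_le_iff)
qed

section \<open>Character sums reduced to subspaces that contain 1\<close>

abbreviation subspaces1 :: "nat \<Rightarrow> 'a set set" where
  "subspaces1 d \<equiv> subspaces_over {0, 1} d"

text \<open>Dividing \<open>W\<close> by its nonzero element w gives a space containing 1, and from
  that space and the scalar w the pair is recovered.\<close>

lemma sum_subspace_elements:
  "(\<Sum>W\<in>subspaces d. \<Sum>w\<in>W - {0}. F W w) = (\<Sum>W\<in>subspaces1 d. \<Sum>w\<in>-{0}. F ((*) w ` W) w)"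
proof -
  have im: "(*) w ` (*) (inverse w) ` W = W" "(*) (inverse w) ` (*) w ` W = W" if "w \<noteq> 0" for w :: 'a and W
    using that by (simp_all add: image_image flip: mult.assoc)
  have sc: "(*) c ` W \<in> subspaces d" if "W \<in> subspaces d" "c \<noteq> 0" for c W
    using that by (auto simp: subspaces_def add_closed_scale card_image inj_on_def)
  have "(\<Sum>W\<in>subspaces d. \<Sum>w\<in>W - {0}. F W w) = (\<Sum>(W, w)\<in>(SIGMA W:subspaces d. W - {0}). F W w)"
    by (simp add: sum.Sigma)
  also have "\<dots> = (\<Sum>(W, w)\<in>(SIGMA W:subspaces1 d. -{0}). F ((*) w ` W) w)"
  proof (rule sum.reindex_bij_witness[of _ "\<lambda>(W, w). ((*) w ` W, w)" "\<lambda>(W, w). ((*) (inverse w) ` W, w)"])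
    fix p assume p: "p \<in> (SIGMA W:subspaces d. W - {0})"
    then obtain W w where [simp]: "p = (W, w)" and W: "W \<in> subspaces d" "w \<in> W" "w \<noteq> 0" by auto
    show "(\<lambda>(W, w). ((*) w ` W, w)) ((\<lambda>(W, w). ((*) (inverse w) ` W, w)) p) = p"
      using im W by simp
    have "1 \<in> (*) (inverse w) ` W" using W by (intro image_eqI[of _ _ w]) auto
    moreover have "0 \<in> (*) (inverse w) ` W" using W by (intro image_eqI[of _ _ 0]) (auto simp: subspaces_def add_closed_def)
    ultimately show "(\<lambda>(W, w). ((*) (inverse w) ` W, w)) p \<in> (SIGMA W:subspaces1 d. -{0})"
      using W sc by (auto simp: subspaces_over_def)
    show "(case (\<lambda>(W, w). ((*) (inverse w) ` W, w)) p of (W, w) \<Rightarrow> F ((*) w ` W) w) = (case p of (W, w) \<Rightarrow> F W w)"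
      using im W by simp
  next
    fix p assume p: "p \<in> (SIGMA W:subspaces1 d. -{0::'a})"
    then obtain W w where [simp]: "p = (W, w)" and W: "W \<in> subspaces d" "0 \<in> W" "1 \<in> W" "w \<noteq> 0"
      by (auto simp: subspaces_over_def)
    show "(\<lambda>(W, w). ((*) (inverse w) ` W, w)) ((\<lambda>(W, w). ((*) w ` W, w)) p) = p"
      using im W by simp
    show "(\<lambda>(W, w). ((*) w ` W, w)) p \<in> (SIGMA W:subspaces d. W - {0})"
      using W sc by auto
  qed
  also have "\<dots> = (\<Sum>W\<in>subspaces1 d. \<Sum>w\<in>-{0}. F ((*) w ` W) w)"
    by (simp add: sum.Sigma)
  finally show ?thesis .
qed

text \<open>The map x^2 + x has kernel {0, 1}, so spaces containing 1 correspond to their images,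
  which lie in \<open>trace_zero\<close>; \<open>inv_sum_tower\<close> accounts for the added
  1.\<close>

lemma sum_subspaces1_Suc:
  "(\<Sum>W\<in>subspaces1 (Suc d). g (inv_sum W)) = (\<Sum>W | W \<in> subspaces d \<and> W \<subseteq> trace_zero. g (1 + inv_sum W))"
proof (rule sum.reindex_bij_witness[of _ "\<lambda>W. {x. root_prod {0, 1} x \<in> W}" "\<lambda>W. root_prod {0, 1} ` W"])
  let ?p = "root_prod {0, 1::'a}"
  note add = root_prod_add[OF add_closed_01]
  have p01: "?p 0 = 0" "?p 1 = 0" by (simp_all add: root_prod_01)
  fix W assume W: "W \<in> subspaces1 (Suc d)"
  hence W': "add_closed W" "{0, 1} \<subseteq> W" "card W = 2 ^ Suc d" by (auto simp: subspaces_over_def subspaces_def)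
  show "{x. ?p x \<in> ?p ` W} = W"
  proof (intro equalityI subsetI)
    fix x assume "x \<in> {x. ?p x \<in> ?p ` W}"
    then obtain w where w: "w \<in> W" "?p (x + w) = 0" by (auto simp: add)
    hence "x + w \<in> W" using W'(2) by (auto simp: root_prod_eq_0_iff)
    thus "x \<in> W" using w W'(1) add_mem_iff' by blast
  qed auto
  have "card W = card (?p ` W) * 2"
    using card_root_prod_image[OF add_closed_01 W'(1,2)] by simp
  thus "?p ` W \<in> {W. W \<in> subspaces d \<and> W \<subseteq> trace_zero}"
    using W' add_closed_root_prod_image[OF add_closed_01 W'(1)] range_root_prod_01 by (auto simp: subspaces_def)
  show "g (1 + inv_sum (?p ` W)) = g (inv_sum W)"
    using inv_sum_tower[OF add_closed_01 W'(1,2)] by (simp add: inv_sum_01 nz_prod_01)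
next
  let ?p = "root_prod {0, 1::'a}"
  note add = root_prod_add[OF add_closed_01]
  have p01: "?p 0 = 0" "?p 1 = 0" by (simp_all add: root_prod_01)
  fix W assume W: "W \<in> {W. W \<in> subspaces d \<and> W \<subseteq> trace_zero}"
  show im: "?p ` {x. ?p x \<in> W} = W" using W range_root_prod_01 by auto
  have V: "add_closed {x. ?p x \<in> W}" "{0, 1} \<subseteq> {x. ?p x \<in> W}"
    using W add p01 by (auto simp: add_closed_def subspaces_def)
  have "card {x. ?p x \<in> W} = card W * 2"
    using card_root_prod_image[OF add_closed_01 V] im by simp
  thus "{x. ?p x \<in> W} \<in> subspaces1 (Suc d)"
    using V W by (auto simp: subspaces_over_def subspaces_def)
qed

lemma inv_sum_scale_div: "w \<noteq> 0 \<Longrightarrow> inv_sum ((*) w ` W) = inv_sum W / (w::'a)"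
  by (metis inv_sum_scale divide_inverse mult.commute)

text \<open>Each \<open>W\<close> is counted once per nonzero element and rescaled by it. For a
  space with inverse sum s, the sum of chi(s/w) over the nonzero w is q - 1 if s = 0, and -1
  otherwise.\<close>

lemma sum_chi_subspaces_bound:
  assumes d: "d \<ge> 1"
  shows "(2 ^ d - 1) * \<bar>\<Sum>W\<in>subspaces d. chi (inv_sum W)\<bar>
    \<le> q * real (card {W\<in>subspaces1 d. inv_sum W = 0}) + real (card (subspaces1 d))"
proof -
  let ?A = "\<Sum>W\<in>subspaces d. chi (inv_sum W)"
  have "(2 ^ d - 1) * ?A = (\<Sum>W\<in>subspaces d. \<Sum>w\<in>W - {0}. chi (inv_sum W))"
  proof -
    have "real (card (W - {0})) = 2 ^ d - 1" if "W \<in> subspaces d" for W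
      using that by (simp add: subspaces_def add_closed_def card_Diff_singleton of_nat_diff)
    thus ?thesis by (simp add: sum_distrib_left)
  qed
  also have "\<dots> = (\<Sum>W\<in>subspaces1 d. \<Sum>w\<in>-{0}. chi (inv_sum ((*) w ` W)))"
    by (rule sum_subspace_elements)
  also have "\<dots> = (\<Sum>W\<in>subspaces1 d. q * (if inv_sum W = 0 then 1 else 0) - 1)"
  proof (rule sum.cong[OF refl])
    fix W :: "'a set"
    have "(\<Sum>w\<in>-{0}. chi (inv_sum ((*) w ` W))) = (\<Sum>w\<in>-{0}. chi (inv_sum W / w))"
      by (intro sum.cong refl) (simp add: inv_sum_scale_div)
    also have "\<dots> = (\<Sum>w\<in>-{0}. chi (inv_sum W * w))" by (rule sum_divide_nonzero)
    also have "\<dots> = q * (if inv_sum W = 0 then 1 else 0) - 1"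
      using sum_chi_nonzero[of "inv_sum W"] card_nonzero by (cases "inv_sum W = 0") simp_all
    finally show "(\<Sum>w\<in>-{0}. chi (inv_sum ((*) w ` W))) = q * (if inv_sum W = 0 then 1 else 0) - 1" .
  qed
  also have "\<dots> = q * real (card {W\<in>subspaces1 d. inv_sum W = 0}) - real (card (subspaces1 d))"
    by (simp add: sum_subtractf sum_distrib_left[symmetric] sum.If_cases Int_def)
  finally have eq: "(2 ^ d - 1) * ?A = q * real (card {W\<in>subspaces1 d. inv_sum W = 0}) - real (card (subspaces1 d))" .
  have "(2 ^ d - 1) * \<bar>?A\<bar> = \<bar>(2 ^ d - 1) * ?A\<bar>" by (simp add: abs_mult)
  also have "\<dots> \<le> q * real (card {W\<in>subspaces1 d. inv_sum W = 0}) + real (card (subspaces1 d))"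
    unfolding eq by (simp add: abs_le_iff)
  finally show ?thesis .
qed

text \<open>The condition that \<open>W\<close> lie in \<open>trace_zero\<close> is detected by the
  sum of chi over \<open>W\<close>. After rescaling by w the argument becomes w + s/w, which
  produces Kloosterman sums.\<close>

lemma sum_chi_subspaces1_Suc:
  "2 ^ d * \<bar>\<Sum>W\<in>subspaces1 (Suc d). chi (inv_sum W)\<bar>
    = \<bar>(\<Sum>W\<in>subspaces d. chi (inv_sum W)) + (\<Sum>W\<in>subspaces1 d. kloosterman (inv_sum W))\<bar>"
proof -
  have "(\<Sum>W\<in>subspaces1 (Suc d). chi (inv_sum W)) = (\<Sum>W | W \<in> subspaces d \<and> W \<subseteq> trace_zero. chi (1 + inv_sum W))"
    by (rule sum_subspaces1_Suc)
  also have "\<dots> = chi 1 * (\<Sum>W | W \<in> subspaces d \<and> W \<subseteq> trace_zero. chi (inv_sum W))"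
    by (simp add: chi_add sum_distrib_left)
  finally have "2 ^ d * \<bar>\<Sum>W\<in>subspaces1 (Suc d). chi (inv_sum W)\<bar>
      = \<bar>\<Sum>W | W \<in> subspaces d \<and> W \<subseteq> trace_zero. 2 ^ d * chi (inv_sum W)\<bar>"
    by (simp add: abs_mult sum_distrib_left[symmetric])
  also have "(\<Sum>W | W \<in> subspaces d \<and> W \<subseteq> trace_zero. 2 ^ d * chi (inv_sum W))
      = (\<Sum>W\<in>subspaces d. \<Sum>w\<in>W. chi (w + inv_sum W))"
  proof -
    have "(\<Sum>w\<in>W. chi (w + inv_sum W)) = (if W \<subseteq> trace_zero then 2 ^ d * chi (inv_sum W) else 0)" if "W \<in> subspaces d" for W
      using that sum_chi_subgroup[of W "\<lambda>x. x"]
      by (auto simp: chi_add subspaces_def sum_distrib_right[symmetric])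
    thus ?thesis by (simp add: sum.If_cases Int_def)
  qed
  also have "\<dots> = (\<Sum>W\<in>subspaces d. chi (inv_sum W) + (\<Sum>w\<in>W - {0}. chi (w + inv_sum W)))"
    by (rule sum.cong[OF refl], subst sum.remove[of _ 0]) (auto simp: subspaces_def add_closed_def)
  also have "\<dots> = (\<Sum>W\<in>subspaces d. chi (inv_sum W)) + (\<Sum>W\<in>subspaces1 d. \<Sum>w\<in>-{0}. chi (w + inv_sum ((*) w ` W)))"
    by (simp only: sum.distrib sum_subspace_elements)
  also have "(\<Sum>W\<in>subspaces1 d. \<Sum>w\<in>-{0}. chi (w + inv_sum ((*) w ` W))) = (\<Sum>W\<in>subspaces1 d. kloosterman (inv_sum W))"
    unfolding kloosterman_def by (rule sum.cong[OF refl], rule sum.cong[OF refl]) (simp add: inv_sum_scale_div)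
  finally show ?thesis .
qed

text \<open>Rescaling a subspace \<open>W\<close> to \<open>inv_sum W = 1\<close> and pulling it back along \<open>x\<^sup>2 + x\<close>,
  whose kernel also has inverse sum 1, gives inverse sum \<open>1 + 1 = 0\<close>.\<close>

lemma zero_sum_dim_of_trace_zero:
  assumes W: "W \<in> subspaces d" "inv_sum W \<noteq> 0" "\<forall>w\<in>W. inv_sum W * w \<in> trace_zero"
  shows "zero_sum_dim (Suc d)"
proof -
  let ?W = "(*) (inv_sum W) ` W"
  have W': "add_closed ?W" "card ?W = 2 ^ d" "inv_sum ?W = 1" "?W \<subseteq> range (root_prod {0, 1})"
    using W by (auto simp: subspaces_def add_closed_scale card_image inj_on_def inv_sum_scale range_root_prod_01)
  show ?thesis
    using ex_tower[OF add_closed_01 W'(1,4)] W'(2,3)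
    by (auto simp: zero_sum_dim_def inv_sum_01 nz_prod_01)
qed

text \<open>If no suitable \<open>W\<close> exists, only spaces with inverse sum 0 contribute to the
  total of \<open>chi (inv_sum W * w)\<close>. The terms with w = 0 alone make that total too
  large.\<close>

lemma zero_sum_dim_of_bounds:
  assumes big: "2 ^ Suc d * real (card {W\<in>subspaces (Suc d). inv_sum W = 0})
     + (q - 1) * \<bar>\<Sum>W\<in>subspaces1 (Suc d). chi (inv_sum W)\<bar> < real (card (subspaces (Suc d)))"
  shows "zero_sum_dim (d + 2)"
proof (rule ccontr)
  assume no: "\<not> zero_sum_dim (d + 2)"
  let ?S = "subspaces (Suc d)" and ?T = "\<Sum>W\<in>subspaces1 (Suc d). chi (inv_sum W)"
  have good: "inv_sum W = 0" if "W \<in> ?S" "\<forall>w\<in>W. inv_sum W * w \<in> trace_zero" for W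
    using zero_sum_dim_of_trace_zero[of W "Suc d"] that no by auto
  have "(\<Sum>W\<in>?S. \<Sum>w\<in>W. chi (inv_sum W * w)) = (\<Sum>W\<in>?S. if inv_sum W = 0 then 2 ^ Suc d else 0)"
  proof (rule sum.cong[OF refl])
    fix W assume W: "W \<in> ?S"
    have "(\<forall>w\<in>W. inv_sum W * w \<in> trace_zero) \<longleftrightarrow> inv_sum W = 0"
      using good[OF W] add_closed_trace_zero by (auto simp: add_closed_def)
    thus "(\<Sum>w\<in>W. chi (inv_sum W * w)) = (if inv_sum W = 0 then 2 ^ Suc d else 0)"
      using W sum_chi_subgroup[of W "(*) (inv_sum W)"] by (simp add: subspaces_def distrib_left)
  qed
  also have "\<dots> = 2 ^ Suc d * real (card {W\<in>?S. inv_sum W = 0})"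
    by (simp add: sum.If_cases Int_def)
  finally have 1: "(\<Sum>W\<in>?S. \<Sum>w\<in>W. chi (inv_sum W * w)) = 2 ^ Suc d * real (card {W\<in>?S. inv_sum W = 0})" .
  have "(\<Sum>W\<in>?S. \<Sum>w\<in>W. chi (inv_sum W * w)) = (\<Sum>W\<in>?S. 1 + (\<Sum>w\<in>W - {0}. chi (inv_sum W * w)))"
    by (rule sum.cong[OF refl], subst sum.remove[of _ 0]) (auto simp: subspaces_def add_closed_def)
  also have "\<dots> = real (card ?S) + (\<Sum>W\<in>subspaces1 (Suc d). \<Sum>w\<in>-{0}. chi (inv_sum ((*) w ` W) * w))"
    by (simp add: sum.distrib sum_subspace_elements)
  \<comment> \<open>The product of w and the inverse sum is invariant under the rescaling, so the
    inner sum is constant and yields the factor \<open>q - 1\<close>.\<close>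
  also have "(\<Sum>W\<in>subspaces1 (Suc d). \<Sum>w\<in>-{0}. chi (inv_sum ((*) w ` W) * w))
      = (\<Sum>W\<in>subspaces1 (Suc d). \<Sum>w\<in>-{0::'a}. chi (inv_sum W))"
    by (rule sum.cong[OF refl], rule sum.cong[OF refl]) (simp add: inv_sum_scale_div)
  also have "\<dots> = (q - 1) * ?T"
    by (simp add: card_nonzero sum_distrib_left)
  finally have "2 ^ Suc d * real (card {W\<in>?S. inv_sum W = 0}) = real (card ?S) + (q - 1) * ?T" using 1 by simp
  moreover have "- \<bar>?T\<bar> \<le> ?T" by simp
  hence "(q - 1) * (- \<bar>?T\<bar>) \<le> (q - 1) * ?T" by (rule mult_left_mono) simp
  ultimately show False using big by simp
qed

section \<open>The dimensions 3 to 12\<close>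

lemma card_subspaces_2: "real (card (subspaces 2)) = (q - 1) * (q - 2) / 6"
  and card_subspaces_3: "real (card (subspaces 3)) = (q - 1) * (q - 2) * (q - 4) / 168"
  and card_subspaces_4: "real (card (subspaces 4)) = (q - 1) * (q - 2) * (q - 4) * (q - 8) / 20160"
  and card_subspaces1_1: "real (card (subspaces1 1)) = 1"
  and card_subspaces1_2: "real (card (subspaces1 2)) = (q - 2) / 2"
  and card_subspaces1_3: "real (card (subspaces1 3)) = (q - 2) * (q - 4) / 24"
proof -
  have 0: "subspaces d = subspaces_over {0} (0 + d)" for d
    by (auto simp: subspaces_over_def subspaces_def add_closed_def)
  have 1: "real (card (subspaces d)) = (\<Prod>i<d. q - 2 ^ i) / ext_count d 0" for d
    unfolding 0 using card_subspaces_over[OF add_closed_0, of 0 d] by simp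
  have 2: "real (card (subspaces1 (1 + d))) = (\<Prod>i<d. q - 2 ^ (1 + i)) / ext_count d 1" for d
    using card_subspaces_over[OF add_closed_01, of 1 d] by simp
  show "real (card (subspaces 2)) = (q - 1) * (q - 2) / 6"
    "real (card (subspaces 3)) = (q - 1) * (q - 2) * (q - 4) / 168"
    "real (card (subspaces 4)) = (q - 1) * (q - 2) * (q - 4) * (q - 8) / 20160"
    by (simp_all add: 1 numeral_eq_Suc)
  show "real (card (subspaces1 1)) = 1" using 2[of 0] by simp
  show "real (card (subspaces1 2)) = (q - 2) / 2" using 2[of 1] by (simp add: numeral_2_eq_2)
  show "real (card (subspaces1 3)) = (q - 2) * (q - 4) / 24" using 2[of 2] by (simp add: numeral_eq_Suc)
qed

text \<open>Assembles the estimates: \<open>z\<close> bounds the number of zero-sum spaces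
  containing 1, and \<open>R\<close> the mean Kloosterman sum. The subtracted fraction in
  \<open>big\<close> pays for the zero-sum spaces of dimension \<open>Suc d\<close>.\<close>

lemma zero_sum_dim_of_kloosterman_bound:
  assumes d: "d \<ge> 1" and q: "2 ^ d < q"
    and Z: "real (card {W\<in>subspaces1 d. inv_sum W = 0}) \<le> z"
    and K: "\<bar>\<Sum>W\<in>subspaces1 d. kloosterman (inv_sum W)\<bar> \<le> R * real (card (subspaces1 d))"
    and big: "(q - 1) * ((q * z + real (card (subspaces1 d))) / (2 ^ d - 1) + R * real (card (subspaces1 d))) / 2 ^ d
      < real (card (subspaces (Suc d))) * (1 - 2 ^ Suc (2 * d) / (q - 2 ^ d))"
  shows "zero_sum_dim (d + 2)"
proof (rule zero_sum_dim_of_bounds)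
  let ?A = "\<Sum>W\<in>subspaces d. chi (inv_sum W)" and ?T = "\<Sum>W\<in>subspaces1 (Suc d). chi (inv_sum W)"
  let ?g = "real (card (subspaces1 d))" and ?N = "real (card (subspaces (Suc d)))"
  have d1: "(2::real) ^ d > 1" using d by (intro one_less_power) auto
  have "(2 ^ d - 1) * \<bar>?A\<bar> \<le> q * real (card {W\<in>subspaces1 d. inv_sum W = 0}) + ?g"
    by (rule sum_chi_subspaces_bound[OF d])
  also have "\<dots> \<le> q * z + ?g" using Z by simp
  finally have "\<bar>?A\<bar> \<le> (q * z + ?g) / (2 ^ d - 1)" using d1 by (simp add: field_simps)
  moreover have "2 ^ d * \<bar>?T\<bar> \<le> \<bar>?A\<bar> + \<bar>\<Sum>W\<in>subspaces1 d. kloosterman (inv_sum W)\<bar>"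
    unfolding sum_chi_subspaces1_Suc by (rule abs_triangle_ineq)
  ultimately have "2 ^ d * \<bar>?T\<bar> \<le> (q * z + ?g) / (2 ^ d - 1) + R * ?g" using K by linarith
  hence T: "\<bar>?T\<bar> \<le> ((q * z + ?g) / (2 ^ d - 1) + R * ?g) / 2 ^ d" by (simp add: pos_le_divide_eq mult.commute)
  have "subspaces (Suc d) = subspaces_over {0} (0 + Suc d)"
    by (auto simp: subspaces_over_def subspaces_def add_closed_def)
  hence "real (card {W\<in>subspaces (Suc d). inv_sum W = 0}) \<le> 2 ^ d / (q - 2 ^ d) * ?N"
    using card_zero_sum_subspaces_le[OF add_closed_0, of 0 d] q by simp
  hence "2 ^ Suc d * real (card {W\<in>subspaces (Suc d). inv_sum W = 0}) \<le> 2 ^ Suc d * (2 ^ d / (q - 2 ^ d) * ?N)"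
    by (rule mult_left_mono) simp
  also have "\<dots> = ?N * (2 ^ Suc (2 * d) / (q - 2 ^ d))"
  proof -
    have "(2::real) ^ Suc (2 * d) = 2 ^ Suc d * 2 ^ d" by (simp only: power_add[symmetric] add_Suc mult_2)
    thus ?thesis by (simp only: times_divide_eq_left times_divide_eq_right mult_ac)
  qed
  finally have "2 ^ Suc d * real (card {W\<in>subspaces (Suc d). inv_sum W = 0}) \<le> ?N * (2 ^ Suc (2 * d) / (q - 2 ^ d))" .
  moreover have "(q - 1) * \<bar>?T\<bar> \<le> (q - 1) * (((q * z + ?g) / (2 ^ d - 1) + R * ?g) / 2 ^ d)"
    by (rule mult_left_mono[OF T]) simp
  ultimately show "2 ^ Suc d * real (card {W\<in>subspaces (Suc d). inv_sum W = 0}) + (q - 1) * \<bar>?T\<bar> < ?N"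
    using big by (simp add: algebra_simps)
qed

lemma zero_sum_dim_3_large:
  assumes "n \<ge> 8"
  shows "zero_sum_dim 3"
proof -
  have q: "q \<ge> 256" using power_increasing[OF assms, of "2::real"] by simp
  \<comment> \<open>For \<open>d = 1\<close> there is a single space, with inverse sum 1, so no
    average is available and \<open>kloosterman 1\<close> itself must be bounded.\<close>
  have one: "subspaces1 1 = {{0, 1}}"
  proof -
    have "{0, 1} \<in> subspaces1 1"
      using add_closed_01 by (simp add: subspaces_over_def subspaces_def)
    thus ?thesis using card_subspaces1_1 by (metis card_1_singletonE of_nat_eq_1_iff singletonD)
  qed
  have "zero_sum_dim (1 + 2)"
  proof (rule zero_sum_dim_of_kloosterman_bound[where z = 0 and R = "\<bar>kloosterman 1\<bar>"])
    show "real (card {W\<in>subspaces1 1. inv_sum W = 0}) \<le> 0"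
      unfolding one by (auto simp: inv_sum_01)
    show "\<bar>\<Sum>W\<in>subspaces1 1. kloosterman (inv_sum W)\<bar> \<le> \<bar>kloosterman 1\<bar> * real (card (subspaces1 1))"
      unfolding one by (simp add: inv_sum_01)
    have "1 + \<bar>kloosterman 1\<bar> < (q - 10) / 3"
      using kloosterman_1_bound[OF assms] q by simp
    hence "(q - 1) * (1 + \<bar>kloosterman 1\<bar>) / 2 < (q - 1) * ((q - 10) / 3) / 2"
      using q by (intro divide_strict_right_mono mult_strict_left_mono) auto
    also have "\<dots> = (q - 1) * (q - 2) / 6 * (1 - 8 / (q - 2))"
      using q by (simp add: field_simps)
    finally show "(q - 1) * ((q * 0 + real (card (subspaces1 1))) / (2 ^ 1 - 1) + \<bar>kloosterman 1\<bar> * real (card (subspaces1 1))) / 2 ^ 1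
      < real (card (subspaces (Suc 1))) * (1 - 2 ^ Suc (2 * 1) / (q - 2 ^ 1))"
      unfolding card_subspaces1_1 Suc_1 card_subspaces_2 by simp
  qed (use q in auto)
  thus ?thesis by (simp add: eval_nat_numeral)
qed

lemma zero_sum_dim_4_large:
  assumes "n \<ge> 11"
  shows "zero_sum_dim 4"
proof -
  have q: "q \<ge> 2048" using power_increasing[OF assms, of "2::real"] by simp
  \<comment> \<open>The square root of 2q is at most q/64 + 32, with equality at q = 2048; the
    additional 1 absorbs the factor (q-1)/(q-2).\<close>
  define R where "R = q / 64 + 33"
  have g: "real (card (subspaces1 2)) = (q - 2) / 2" by (rule card_subspaces1_2)
  have "zero_sum_dim (2 + 2)"
  proof (rule zero_sum_dim_of_kloosterman_bound[where z = 1 and R = R])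
    have e: "1 + Suc 0 = 2" by simp
    have "real (card {W\<in>subspaces1 (1 + Suc 0). inv_sum W = 0}) \<le> 2 ^ (1 + 0) / (q - 2 ^ (1 + 0)) * real (card (subspaces1 (1 + Suc 0)))"
      by (rule card_zero_sum_subspaces_le[OF add_closed_01]) (use q in auto)
    also have "\<dots> = 1" unfolding e g using q by (simp add: field_simps)
    finally show "real (card {W\<in>subspaces1 2. inv_sum W = 0}) \<le> 1" unfolding e .
    have "0 \<le> (q / 64 - 32)\<^sup>2" by simp
    hence "2 * q + q / 32 + 65 \<le> R\<^sup>2" by (simp add: R_def power2_eq_square algebra_simps)
    hence "(2 * q + 64 + 65) * (q - 2) \<le> R\<^sup>2 * (q - 2)"
      using q by (intro mult_right_mono) auto
    moreover have "2 * (q * (q - 1)) \<le> (2 * q + 64 + 65) * (q - 2)"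
      using q by (simp add: algebra_simps)
    ultimately have "2 ^ (1 + 0) * (q * (q - 1)) \<le> R\<^sup>2 * (q - 2 ^ (1 + 0))" by simp
    hence "\<bar>\<Sum>W\<in>subspaces1 (1 + Suc 0). kloosterman (inv_sum W)\<bar> \<le> R * real (card (subspaces1 (1 + Suc 0)))"
      using q by (intro sum_kloosterman_subspaces_le add_closed_01) (auto simp: R_def)
    thus "\<bar>\<Sum>W\<in>subspaces1 2. kloosterman (inv_sum W)\<bar> \<le> R * real (card (subspaces1 2))"
      unfolding e .
    have "(q + (q - 2) / 2) / 3 + R * ((q - 2) / 2) \<le> (q - 2) * ((R + 2) / 2)"
      using q by (simp add: field_simps)
    also have "\<dots> < (q - 2) * ((q - 36) / 42)"
      using q by (intro mult_strict_left_mono) (auto simp: R_def)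
    finally have "(q - 1) * ((q + (q - 2) / 2) / 3 + R * ((q - 2) / 2)) / 4 < (q - 1) * ((q - 2) * ((q - 36) / 42)) / 4"
      using q by (intro divide_strict_right_mono mult_strict_left_mono) auto
    also have "\<dots> = (q - 1) * (q - 2) * (q - 4) / 168 * (1 - 32 / (q - 4))"
      using q by (simp add: field_simps)
    finally show "(q - 1) * ((q * 1 + real (card (subspaces1 2))) / (2 ^ 2 - 1) + R * real (card (subspaces1 2))) / 2 ^ 2
      < real (card (subspaces (Suc 2))) * (1 - 2 ^ Suc (2 * 2) / (q - 2 ^ 2))"
      unfolding g Suc_numeral add_num_simps card_subspaces_3 by simp
  qed (use q in auto)
  thus ?thesis by (simp add: eval_nat_numeral)
qed

lemma zero_sum_dim_5_large:
  assumes "n \<ge> 16"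
  shows "zero_sum_dim 5"
proof -
  have q: "q \<ge> 65536" using power_increasing[OF assms, of "2::real"] by simp
  \<comment> \<open>As for dimension 4: the square root of 4q is at most q/256 + 256, with equality
    at q = 65536, and 1 is added as slack.\<close>
  define R where "R = q / 256 + 257"
  have g: "real (card (subspaces1 3)) = (q - 2) * (q - 4) / 24" by (rule card_subspaces1_3)
  have "zero_sum_dim (3 + 2)"
  proof (rule zero_sum_dim_of_kloosterman_bound[where z = "(q - 2) / 6" and R = R])
    have e: "1 + Suc 1 = 3" by simp
    have "real (card {W\<in>subspaces1 (1 + Suc 1). inv_sum W = 0}) \<le> 2 ^ (1 + 1) / (q - 2 ^ (1 + 1)) * real (card (subspaces1 (1 + Suc 1)))"
      by (rule card_zero_sum_subspaces_le[OF add_closed_01]) (use q in auto)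
    also have "\<dots> = (q - 2) / 6" unfolding e g using q by (simp add: field_simps)
    finally show "real (card {W\<in>subspaces1 3. inv_sum W = 0}) \<le> (q - 2) / 6" unfolding e .
    have "0 \<le> (q / 256 - 256)\<^sup>2" by simp
    hence "4 * q + q / 128 + 513 \<le> R\<^sup>2" by (simp add: R_def power2_eq_square algebra_simps)
    hence "(4 * q + 512) * (q - 4) \<le> R\<^sup>2 * (q - 4)"
      using q by (intro mult_right_mono) auto
    moreover have "4 * (q * (q - 1)) \<le> (4 * q + 512) * (q - 4)"
      using q by (simp add: algebra_simps)
    ultimately have "2 ^ (1 + 1) * (q * (q - 1)) \<le> R\<^sup>2 * (q - 2 ^ (1 + 1))" by simp
    hence "\<bar>\<Sum>W\<in>subspaces1 (1 + Suc 1). kloosterman (inv_sum W)\<bar> \<le> R * real (card (subspaces1 (1 + Suc 1)))"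
      using q by (intro sum_kloosterman_subspaces_le add_closed_01) (auto simp: R_def)
    thus "\<bar>\<Sum>W\<in>subspaces1 3. kloosterman (inv_sum W)\<bar> \<le> R * real (card (subspaces1 3))"
      unfolding e .
    have "(q * ((q - 2) / 6) + (q - 2) * (q - 4) / 24) / 7 + R * ((q - 2) * (q - 4) / 24)
        = (q - 2) * ((q / 6 + (q - 4) / 24) / 7 + R * (q - 4) / 24)"
      by (simp add: field_simps)
    also have "\<dots> \<le> (q - 2) * ((q - 4) * ((R + 1) / 24))"
      using q by (intro mult_left_mono) (auto simp: field_simps)
    also have "\<dots> < (q - 2) * ((q - 4) * ((q - 136) / 2520))"
      using q by (intro mult_strict_left_mono) (auto simp: R_def)
    finally have "(q - 1) * ((q * ((q - 2) / 6) + (q - 2) * (q - 4) / 24) / 7 + R * ((q - 2) * (q - 4) / 24)) / 8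
        < (q - 1) * ((q - 2) * ((q - 4) * ((q - 136) / 2520))) / 8"
      using q by (intro divide_strict_right_mono mult_strict_left_mono) auto
    also have "\<dots> = (q - 1) * (q - 2) * (q - 4) * (q - 8) / 20160 * (1 - 128 / (q - 8))"
    proof -
      have "(q - 8) * (1 - 128 / (q - 8)) = q - 136" using q by (simp add: field_simps)
      moreover have "(q - 1) * (q - 2) * (q - 4) * (q - 8) / 20160 * (1 - 128 / (q - 8))
          = (q - 1) * (q - 2) * (q - 4) / 20160 * ((q - 8) * (1 - 128 / (q - 8)))" by simp
      ultimately show ?thesis by simp
    qed
    finally show "(q - 1) * ((q * ((q - 2) / 6) + real (card (subspaces1 3))) / (2 ^ 3 - 1) + R * real (card (subspaces1 3))) / 2 ^ 3
      < real (card (subspaces (Suc 3))) * (1 - 2 ^ Suc (2 * 3) / (q - 2 ^ 3))"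
      unfolding g Suc_numeral add_num_simps card_subspaces_4 by simp
  qed (use q in auto)
  thus ?thesis by (simp add: eval_nat_numeral)
qed

section \<open>Case distinction for each dimension\<close>

lemma zero_sum_dim_3:
  assumes "n \<ge> 6"
  shows "zero_sum_dim 3"
proof -
  consider "n = 6" | "n = 7" | "n \<ge> 8" using assms by linarith
  thus ?thesis
  proof cases
    case 1
    thus ?thesis by (intro zero_sum_dim_of_common_divisor[of 3]) auto
  next
    case 2
    show ?thesis by (rule zero_sum_dim_certificate[OF certificate_3_7]) (use 2 in simp_all)
  qed (rule zero_sum_dim_3_large)
qed

lemma zero_sum_dim_6:
  assumes "n \<ge> 10"
  shows "zero_sum_dim 6"
  using zero_sum_dim_add[of 3 3] zero_sum_dim_3 assms by simp

lemma zero_sum_dim_4: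
  assumes "n \<ge> 8"
  shows "zero_sum_dim 4"
proof -
  consider "n = 8 \<or> n = 10" | "n = 9" | "n \<ge> 11" using assms by linarith
  thus ?thesis
  proof cases
    case 1
    thus ?thesis by (intro zero_sum_dim_of_common_divisor[of 2]) auto
  next
    case 2
    show ?thesis by (rule zero_sum_dim_certificate[OF certificate_4_9]) (use 2 in simp_all)
  qed (rule zero_sum_dim_4_large)
qed

lemma zero_sum_dim_5:
  assumes "n \<ge> 10"
  shows "zero_sum_dim 5"
proof -
  consider "n = 10 \<or> n = 15" | "n = 11" | "n = 13" | "n = 12 \<or> n = 14" | "n \<ge> 16"
    using assms by linarith
  thus ?thesis
  proof cases
    case 1
    thus ?thesis by (intro zero_sum_dim_of_common_divisor[of 5]) auto
  next
    case 2
    \<comment> \<open>Here 5 = 11 - 6, and dimension 6 = 3 + 3 is available because 9 < 11.\<close>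
    thus ?thesis using zero_sum_dim_dual[OF zero_sum_dim_6] by simp
  next
    case 3
    show ?thesis by (rule zero_sum_dim_certificate[OF certificate_5_13]) (use 3 in simp_all)
  next
    case 4
    hence "zero_sum_dim 2" by (intro zero_sum_dim_of_common_divisor[of 2]) auto
    thus ?thesis using zero_sum_dim_add[of 2 3] zero_sum_dim_3 4 by auto
  qed (rule zero_sum_dim_5_large)
qed

lemma zero_sum_dim_7:
  assumes "n \<ge> 14"
  shows "zero_sum_dim 7"
  using zero_sum_dim_add[of 3 4] zero_sum_dim_3 zero_sum_dim_4 assms by simp

lemma zero_sum_dim_8:
  assumes "n \<ge> 16"
  shows "zero_sum_dim 8"
  using zero_sum_dim_add[of 3 5] zero_sum_dim_3 zero_sum_dim_5 assms by simp

text \<open>From here on the splitting k = 3 + (k - 3) requires 3(k - 3) < n, which is no longer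
  implied by 2k <= n; the few n in between are treated separately.\<close>

lemma zero_sum_dim_9:
  assumes "n \<ge> 18"
  shows "zero_sum_dim 9"
proof (cases "n = 18")
  case True
  thus ?thesis by (intro zero_sum_dim_of_common_divisor[of 9]) auto
next
  case False
  thus ?thesis using zero_sum_dim_add[of 3 6] zero_sum_dim_3 zero_sum_dim_6 assms by simp
qed

lemma zero_sum_dim_10:
  assumes "n \<ge> 20"
  shows "zero_sum_dim 10"
proof -
  consider "n = 20" | "n = 21" | "n \<ge> 22" using assms by linarith
  thus ?thesis
  proof cases
    case 1
    thus ?thesis by (intro zero_sum_dim_of_common_divisor[of 10]) auto
  next
    case 2
    show ?thesis by (rule zero_sum_dim_certificate[OF certificate_10_21]) (use 2 in simp_all)
  next
    case 3
    thus ?thesis using zero_sum_dim_add[of 3 7] zero_sum_dim_3 zero_sum_dim_7 by simp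
  qed
qed

lemma zero_sum_dim_11:
  assumes "n \<ge> 22"
  shows "zero_sum_dim 11"
proof -
  consider "n = 22" | "n = 23" | "n = 24" | "n \<ge> 25" using assms by linarith
  thus ?thesis
  proof cases
    case 1
    thus ?thesis by (intro zero_sum_dim_of_common_divisor[of 11]) auto
  next
    case 2
    show ?thesis by (rule zero_sum_dim_certificate[OF certificate_11_23]) (use 2 in simp_all)
  next
    case 3
    show ?thesis by (rule zero_sum_dim_certificate[OF certificate_11_24]) (use 3 in simp_all)
  next
    case 4
    thus ?thesis using zero_sum_dim_add[of 3 8] zero_sum_dim_3 zero_sum_dim_8 by simp
  qed
qed

lemma zero_sum_dim_12:
  assumes "n \<ge> 24"
  shows "zero_sum_dim 12"
proof -
  consider "n = 24 \<or> n = 27" | "n = 26" | "n = 25" | "n \<ge> 28" using assms by linarith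
  thus ?thesis
  proof cases
    case 1
    thus ?thesis by (intro zero_sum_dim_of_common_divisor[of 3]) auto
  next
    case 2
    thus ?thesis by (intro zero_sum_dim_of_common_divisor[of 2]) auto
  next
    case 3
    show ?thesis by (rule zero_sum_dim_certificate[OF certificate_12_25]) (use 3 in simp_all)
  next
    case 4
    thus ?thesis using zero_sum_dim_add[of 3 9] zero_sum_dim_3 zero_sum_dim_9 by simp
  qed
qed

lemma zero_sum_dim_le_half:
  assumes "3 \<le> k" "k \<le> 12" "2 * k \<le> n"
  shows "zero_sum_dim k"
proof -
  have "k = 3 \<or> k = 4 \<or> k = 5 \<or> k = 6 \<or> k = 7 \<or> k = 8 \<or> k = 9 \<or> k = 10 \<or> k = 11 \<or> k = 12"
    using assms by presburger
  thus ?thesis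
    using assms(3) zero_sum_dim_3 zero_sum_dim_4 zero_sum_dim_5 zero_sum_dim_6 zero_sum_dim_7
      zero_sum_dim_8 zero_sum_dim_9 zero_sum_dim_10 zero_sum_dim_11 zero_sum_dim_12
    by (elim disjE) simp_all
qed

lemma zero_sum_dim_le_12:
  assumes "3 \<le> k" "k \<le> 12" "k + 3 \<le> n"
  shows "zero_sum_dim k"
proof (cases "2 * k \<le> n")
  case True
  thus ?thesis using zero_sum_dim_le_half assms by blast
next
  case False
  \<comment> \<open>As n < 2k, the complementary dimension is less than k and at most n/2; it is at
    least 3 by the assumption on n.\<close>
  hence "zero_sum_dim (n - k)" using assms by (intro zero_sum_dim_le_half) auto
  from zero_sum_dim_dual[OF this] show ?thesis using assms by simp
qed

section \<open>Back to vector space dimension and sum-freeness\<close>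

lemma dim_f2_of_card:
  assumes V: "add_closed (V::'a set)" "card V = 2 ^ k"
  shows "module.subspace f2_scale V \<and> vector_space.dim f2_scale V = k"
proof -
  interpret V: vector_space "f2_scale :: bit \<Rightarrow> 'a \<Rightarrow> 'a"
    using vector_space_f2_scale card_UNIV_eq .
  have sub: "V.subspace V"
    using V(1) by (auto simp: V.subspace_def add_closed_def f2_scale_def)
  \<comment> \<open>Each new independent vector doubles the span, since over the prime field the new
    span is \<open>adjoin\<close> of the old one; the dimension is then read off the size.\<close>
  have "card (V.span B) = 2 ^ card B" if "finite B" "V.independent B" for B
    using that
  proof (induction B rule: finite_induct)
    case empty
    show ?case by simp
  next
    case (insert b B)
    have ind: "V.independent B" "b \<notin> V.span B"
      using insert.prems insert.hyps by (auto simp: V.independent_insert)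
    have cl: "add_closed (V.span B)" by (auto simp: add_closed_def V.span_add V.span_zero)
    have "V.span (insert b B) = adjoin (V.span B) b"
    proof (intro equalityI subsetI)
      fix x assume "x \<in> V.span (insert b B)"
      then obtain c where "x - f2_scale c b \<in> V.span B" by (auto simp: V.span_insert)
      thus "x \<in> adjoin (V.span B) b"
        by (auto simp: f2_scale_def adjoin_def diff_eq_add image_iff split: if_splits)
          (metis add_self_right)
    next
      fix x assume "x \<in> adjoin (V.span B) b"
      hence "x - f2_scale 0 b \<in> V.span B \<or> x - f2_scale 1 b \<in> V.span B"
        by (auto simp: adjoin_def f2_scale_def)
      thus "x \<in> V.span (insert b B)" unfolding V.span_insert by blast
    qed
    thus ?case using card_adjoin[OF cl ind(2)] insert.IH[OF ind(1)] insert.hyps by simp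
  qed
  moreover obtain B where B: "B \<subseteq> V" "V.independent B" "V \<subseteq> V.span B" "card B = V.dim V"
    using V.basis_exists by blast
  moreover have "V.span B = V"
    using B sub V.span_mono V.span_eq_iff by (metis subset_antisym)
  moreover have "finite B" by simp
  ultimately have "2 ^ k = (2::nat) ^ V.dim V" using V(2) by metis
  hence "V.dim V = k" by simp
  thus ?thesis using sub by blast
qed

lemma not_sum_free_f_inv:
  assumes "zero_sum_dim k"
  shows "\<not> sum_free k (f_inv :: 'a \<Rightarrow> 'a)"
proof -
  obtain V :: "'a set" where V: "add_closed V" "card V = 2 ^ k" "inv_sum V = 0"
    using assms by (auto simp: zero_sum_dim_def)
  have "f2_affine_subspace k V"
    unfolding f2_affine_subspace_def using dim_f2_of_card[OF V(1,2)]
    by (intro exI[of _ 0] exI[of _ V]) simp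
  moreover have "f_inv = (inverse :: 'a \<Rightarrow> 'a)" by (rule ext) (simp add: f_inv_def)
  hence "(\<Sum>x\<in>V. f_inv x) = 0" using V(3) by (simp add: inv_sum_def)
  ultimately show ?thesis unfolding sum_free_def by blast
qed

end

theorem corollary5p5:
  fixes k n :: nat
  assumes "CARD('a::{field,finite}) = 2 ^ n"
    and "3 \<le> k" and "k \<le> 12" and "n \<ge> k + 3"
  shows "k \<in> \<K> TYPE('a) n"
proof -
  interpret binary_field "TYPE('a)" n by unfold_locales (rule assms(1))
  have "zero_sum_dim k" using assms by (intro zero_sum_dim_le_12) auto
  from not_sum_free_f_inv[OF this] show ?thesis using assms by (simp add: \<K>_def)
qed

end
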